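(* Consider bond percolation on $\mathbb{L}_3$ (dimension $d=3$). The $1$-entanglement critical probability satisfies $$p_{\mathrm e}^1\ge\mu_3^{-2}.$$ Moreover, if $p<\mu_3^{-2}$, then the $1$-entanglement cluster $E$ at the origin satisfies the following: for any $\alpha\in(\mu_3p,1)$ there exists $C=C(p,\alpha)<\infty$ such that $$\mathbb{P}_p\big(\operatorname{rad}[E]\ge r\big)\le C\alpha^r,\qquad r>0.$$
   Context: Elements of $\mathbb{Z}^3$ are called sites. A bond is the closed line segment in $\mathbb{R}^3$ joining two sites $x,y\in\mathbb{Z}^3$ with $\|x-y\|_1=1$; $\mathbb{L}_3$ is the set of all bonds. For a set $K$ of bonds, $[K]:=\bigcup_{e\in K}e\subseteq\mathbb{R}^3$, and $K$ is said to contain a site $x$ if $x\in[K]$. Bond percolation with parameter $p\in[0,1]$: each bond is declared occupied with probability $p$ and otherwise unoccupied, independently for different bonds; the probability measure is $\mathbb{P}_p$. A sphere of $\mathbb{R}^3$ is a simplicial complex, embedded in $\mathbb{R}^3$, that is homeomorphic to the unit sphere $\{x\in\mathbb{R}^3:\|x\|_2=1\}$. The complement of a sphere has one bounded and one unbounded path-component, called respectively its inside and its outside. A sphere $Z$ separates a set $A\subset\mathbb{R}^3$ if $A$ intersects both the inside and the outside of $Z$, but not $Z$ itself. A set of bonds $K\subseteq\mathbb{L}_3$ is $1$-entangled if no sphere of $\mathbb{R}^3$ separates $[K]$. Let $\eta^1(p)$ be the $\mathbb{P}_p$-probability that there exists an infinite $1$-entangled set of occupied bonds containing the origin $0$, and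 let $p_{\mathrm e}^1:=\sup\{p:\eta^1(p)=0\}$. The maximal $1$-entangled set of occupied bonds containing a site $x$ is called the $1$-entanglement cluster at $x$ (it is taken to be empty if no occupied bond is incident to $x$). The radius of $A\subseteq\mathbb{R}^3$ is $\operatorname{rad}A:=\sup\{\|x\|_1:x\in A\}$, with $\operatorname{rad}\varnothing:=0$. The connective constant of $\mathbb{Z}^3$ is $\mu_3:=\lim_{k\to\infty}\sigma(k)^{1/k}$, where $\sigma(k)$ is the number of nearest-neighbour self-avoiding paths of length $k$ in $\mathbb{Z}^3$ starting at the origin. *)

theory Defs
  imports "HOL-Probability.Probability"
begin

definition l1_norm :: "real ^ 3 \<Rightarrow> real"
  where "l1_norm x = (\<Sum>i\<in>UNIV. \<bar>x $ i\<bar>)"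

definition sites :: "(real ^ 3) set"
  where "sites = {x. \<forall>i. x $ i \<in> \<int>}"

definition bonds :: "(real ^ 3) set set"
  where "bonds = {closed_segment x y | x y. x \<in> sites \<and> y \<in> sites \<and> l1_norm (x - y) = 1}"

text \<open>
  The set \<open>[K]\<close> of the points covered by a set \<open>K\<close> of bonds is \<open>\<Union> K\<close>, since bonds are
  themselves point sets.
\<close>

definition polyhedral_sphere :: "(real ^ 3) set \<Rightarrow> bool"
  where "polyhedral_sphere Z \<longleftrightarrow>
    (\<exists>\<C>. simplicial_complex \<C> \<and> Z = \<Union> \<C>) \<and> Z homeomorphic sphere (0 :: real ^ 3) 1"

text \<open>
  The library sets \<^const>\<open>inside\<close> and \<^const>\<open>outside\<close> are formulated with connected components of the
  complement. For a sphere these are the path components.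
\<close>

lemma polyhedral_sphere_closed: "closed Z" if "polyhedral_sphere Z"
proof -
  have "Z homeomorphic sphere (0 :: real ^ 3) 1"
    using that by (simp add: polyhedral_sphere_def)
  then show ?thesis
    by (meson compact_imp_closed compact_sphere homeomorphic_compactness)
qed

lemma inside_polyhedral_sphere:
  assumes "polyhedral_sphere Z"
  shows "inside Z = {x. x \<notin> Z \<and> bounded (path_component_set (- Z) x)}"
  using polyhedral_sphere_closed[OF assms]
  by (simp add: inside_def open_path_connected_component_set open_Compl)

lemma outside_polyhedral_sphere:
  assumes "polyhedral_sphere Z"
  shows "outside Z = {x. x \<notin> Z \<and> \<not> bounded (path_component_set (- Z) x)}"
  using polyhedral_sphere_closed[OF assms]
  by (auto simp: outside_def open_path_connected_component_set open_Compl)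

definition separates :: "(real ^ 3) set \<Rightarrow> (real ^ 3) set \<Rightarrow> bool"
  where "separates Z A \<longleftrightarrow> A \<inter> inside Z \<noteq> {} \<and> A \<inter> outside Z \<noteq> {} \<and> A \<inter> Z = {}"

definition one_entangled :: "(real ^ 3) set set \<Rightarrow> bool"
  where "one_entangled K \<longleftrightarrow> K \<subseteq> bonds \<and> \<not> (\<exists>Z. polyhedral_sphere Z \<and> separates Z (\<Union> K))"

definition percolation :: "real \<Rightarrow> ((real ^ 3) set \<Rightarrow> bool) measure"
  where "percolation p = PiM bonds (\<lambda>_. measure_pmf (bernoulli_pmf p))"

definition occupied :: "((real ^ 3) set \<Rightarrow> bool) \<Rightarrow> (real ^ 3) set set"
  where "occupied \<omega> = {e \<in> bonds. \<omega> e}"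

definition eta1 :: "real \<Rightarrow> real"
  where "eta1 p = measure (percolation p)
    {\<omega> \<in> space (percolation p).
      \<exists>K \<subseteq> occupied \<omega>. infinite K \<and> one_entangled K \<and> 0 \<in> \<Union> K}"

definition entanglement_critical_prob :: real
  where "entanglement_critical_prob = Sup {p \<in> {0..1}. eta1 p = 0}"

text \<open>
  The order on sets is inclusion, so \<open>GREATEST\<close> picks the entangled set at \<open>x\<close> that contains all
  others. It exists by \<open>entanglement_cluster_greatest\<close> below.
\<close>

definition entanglement_cluster :: "((real ^ 3) set \<Rightarrow> bool) \<Rightarrow> real ^ 3 \<Rightarrow> (real ^ 3) set set"
  where "entanglement_cluster \<omega> x =
    (if \<exists>e \<in> occupied \<omega>. x \<in> e
     then GREATEST K. K \<subseteq> occupied \<omega> \<and> one_entangled K \<and> x \<in> \<Union> K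
     else {})"

lemma one_entangled_singleton:
  assumes "e \<in> bonds" shows "one_entangled {e}"
  unfolding one_entangled_def
proof (intro conjI notI)
  show "{e} \<subseteq> bonds" using assms by simp
  assume "\<exists>Z. polyhedral_sphere Z \<and> separates Z (\<Union> {e})"
  then obtain Z a b where Z: "e \<inter> Z = {}" "a \<in> e" "a \<in> inside Z" "b \<in> e" "b \<in> outside Z"
    by (auto simp: separates_def)
  have "connected e" using assms by (auto simp: bonds_def)
  then have "connected_component (- Z) a b"
    using Z unfolding connected_component_def by blast
  then have "b \<in> inside Z" using Z inside_same_component by blast
  then show False using Z inside_Int_outside by blast
qed

lemma one_entangled_Union:
  assumes "\<And>K. K \<in> \<K> \<Longrightarrow> one_entangled K \<and> x \<in> \<Union> K"
  shows "one_entangled (\<Union> \<K>)"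
  unfolding one_entangled_def
proof (intro conjI notI)
  show "\<Union> \<K> \<subseteq> bonds" using assms by (auto simp: one_entangled_def)
  assume "\<exists>Z. polyhedral_sphere Z \<and> separates Z (\<Union> (\<Union> \<K>))"
  then obtain Z where Z: "polyhedral_sphere Z" "separates Z (\<Union> (\<Union> \<K>))" by blast
  then obtain K a L b where
    K: "K \<in> \<K>" "a \<in> \<Union> K" "a \<in> inside Z" and L: "L \<in> \<K>" "b \<in> \<Union> L" "b \<in> outside Z"
    unfolding separates_def by blast
  have disj: "\<Union> K \<inter> Z = {}" "\<Union> L \<inter> Z = {}" using Z K L by (auto simp: separates_def)
  have "\<not> separates Z (\<Union> K)" "\<not> separates Z (\<Union> L)"
    using assms K L Z by (auto simp: one_entangled_def)
  then have "\<Union> K \<inter> outside Z = {}" "\<Union> L \<inter> inside Z = {}"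
    using K L disj unfolding separates_def by blast+
  moreover have "x \<in> \<Union> K" "x \<in> \<Union> L" using assms K L by auto
  moreover have "x \<in> inside Z \<union> outside Z"
    using disj \<open>x \<in> \<Union> K\<close> by (simp del: Union_iff) blast
  ultimately show False by blast
qed

lemma entanglement_cluster_greatest:
  assumes "e \<in> occupied \<omega>" "x \<in> e"
  shows "entanglement_cluster \<omega> x \<subseteq> occupied \<omega>"
    and "one_entangled (entanglement_cluster \<omega> x)"
    and "x \<in> \<Union> (entanglement_cluster \<omega> x)"
    and "\<And>K. \<lbrakk>K \<subseteq> occupied \<omega>; one_entangled K; x \<in> \<Union> K\<rbrakk> \<Longrightarrow> K \<subseteq> entanglement_cluster \<omega> x"
proof -
  define P where "P K \<longleftrightarrow> K \<subseteq> occupied \<omega> \<and> one_entangled K \<and> x \<in> \<Union> K" for K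
  have "one_entangled {e}"
    using assms one_entangled_singleton by (simp add: occupied_def)
  then have "P {e}" using assms by (simp add: P_def)
  moreover have "one_entangled (\<Union> {K. P K})"
    by (rule one_entangled_Union[where x = x]) (auto simp: P_def)
  ultimately have P: "P (\<Union> {K. P K})"
    unfolding P_def by blast
  have "entanglement_cluster \<omega> x = (GREATEST K. P K)"
    using assms unfolding entanglement_cluster_def P_def by auto
  also have "\<dots> = \<Union> {K. P K}"
    by (rule Greatest_equality) (use P in auto)
  finally have eq: "entanglement_cluster \<omega> x = \<Union> {K. P K}" .
  show "entanglement_cluster \<omega> x \<subseteq> occupied \<omega>" "one_entangled (entanglement_cluster \<omega> x)"
    "x \<in> \<Union> (entanglement_cluster \<omega> x)"
    unfolding eq using P unfolding P_def[of "\<Union> {K. P K}"] by blast+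
  show "K \<subseteq> entanglement_cluster \<omega> x"
    if "K \<subseteq> occupied \<omega>" "one_entangled K" "x \<in> \<Union> K" for K
    using that unfolding eq P_def by blast
qed

text \<open>
  The radius is \<open>\<infinity>\<close> for unbounded sets, hence the codomain. The supremum of the empty set
  in \<^typ>\<open>ennreal\<close> is \<open>0\<close>.
\<close>

definition rad :: "(real ^ 3) set \<Rightarrow> ennreal"
  where "rad A = (SUP x\<in>A. ennreal (l1_norm x))"

definition self_avoiding_paths :: "nat \<Rightarrow> (real ^ 3) list set"
  where "self_avoiding_paths k = {xs. length xs = Suc k \<and> hd xs = 0 \<and> set xs \<subseteq> sites \<and> distinct xs \<and>
    (\<forall>i<k. l1_norm (xs ! Suc i - xs ! i) = 1)}"

definition connective_constant :: real
  where "connective_constant = lim (\<lambda>k. root k (real (card (self_avoiding_paths k))))"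

end

theory Submission
  imports Defs
begin

text \<open>
  Explore from the origin along lattice paths that may always step towards the origin (in the
  \<open>\<ell>\<^sup>1\<close>-norm) but step away from it only along occupied bonds. The set \<open>R\<close> of reachable sites is closed
  under moving coordinates towards \<open>0\<close>, so if it is finite, the union of the unit cubes centred at \<open>R\<close> is
  strictly star-shaped about \<open>0\<close> and its boundary is a polyhedral sphere. A bond crossing this
  sphere leads outwards from \<open>R\<close>, hence is unoccupied. So every \<open>1\<close>-entangled set of
  occupied bonds at \<open>0\<close> stays among the sites of \<open>R\<close>.

  A path of length \<open>k\<close> to a site of norm \<open>m\<close> has exactly \<open>(k + m) / 2\<close> outward steps. Hence
  a site of norm at least \<open>n\<close> is reachable with probability at most
  \<open>\<Sum>\<^bsub>k \<ge> n\<^esub> \<sigma>(k) p\<^bsup>(k + n) / 2\<^esup>\<close>, which is of order \<open>(\<mu> p)\<^sup>n\<close> for each \<open>\<mu> > \<mu>\<^sub>3\<close> with \<open>\<mu>\<^sup>2 p < 1\<close>.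
\<close>

section \<open>Unit cubes and sites\<close>

lemma l1_norm_nonneg: "0 \<le> l1_norm x"
  by (simp add: l1_norm_def sum_nonneg)

lemma l1_norm_0 [simp]: "l1_norm 0 = 0"
  by (simp add: l1_norm_def)

lemma l1_norm_minus_commute: "l1_norm (x - y) = l1_norm (y - x)"
  by (simp add: l1_norm_def abs_minus_commute)

lemma l1_norm_triangle: "l1_norm (x + y) \<le> l1_norm x + l1_norm y"
  by (simp add: l1_norm_def sum.distrib [symmetric] sum_mono abs_triangle_ineq)

lemma abs_nth_le_l1_norm: "\<bar>x $ i\<bar> \<le> l1_norm x"
  unfolding l1_norm_def by (rule member_le_sum) auto

lemma zero_mem_sites [simp]: "0 \<in> sites"
  by (simp add: sites_def)

lemma diff_mem_sites: "x \<in> sites \<Longrightarrow> y \<in> sites \<Longrightarrow> x - y \<in> sites"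
  by (simp add: sites_def)

lemma l1_norm_Ints: "x \<in> sites \<Longrightarrow> l1_norm x \<in> \<int>"
  by (auto simp: l1_norm_def sites_def)

lemma Ints_close_imp_eq:
  fixes a b :: real
  assumes "a \<in> \<int>" "b \<in> \<int>" "\<bar>a - b\<bar> < 1"
  shows "a = b"
  using assms by (auto elim!: Ints_cases)

lemma sites_close_imp_eq:
  assumes "x \<in> sites" "y \<in> sites" "\<And>i. \<bar>x $ i - y $ i\<bar> < 1"
  shows "x = y"
  using assms by (auto simp: vec_eq_iff sites_def intro: Ints_close_imp_eq)

lemma finite_sites_bounded: "finite {x \<in> sites. \<forall>i. \<bar>x $ i\<bar> \<le> B}"
proof (rule finite_subset)
  let ?I = "real_of_int ` {-\<lceil>B\<rceil>..\<lceil>B\<rceil>}"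
  show "finite (vec_lambda ` (UNIV \<rightarrow>\<^sub>E ?I) :: (real ^ 3) set)"
    by (intro finite_imageI finite_PiE) auto
  show "{x \<in> sites. \<forall>i. \<bar>x $ i\<bar> \<le> B} \<subseteq> vec_lambda ` (UNIV \<rightarrow>\<^sub>E ?I)"
  proof clarify
    fix x :: "real ^ 3"
    assume x: "x \<in> sites" "\<forall>i. \<bar>x $ i\<bar> \<le> B"
    have "x $ i \<in> ?I" for i
    proof -
      obtain n where n: "x $ i = of_int n"
        using x(1) by (auto simp: sites_def elim: Ints_cases)
      then have "\<bar>real_of_int n\<bar> \<le> B" using x(2) by metis
      then show ?thesis using n by (auto intro!: imageI) linarith+
    qed
    then show "x \<in> vec_lambda ` (UNIV \<rightarrow>\<^sub>E ?I)"
      by (intro image_eqI [where x = "vec_nth x"]) auto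
  qed
qed

definition adjacent :: "real ^ 3 \<Rightarrow> real ^ 3 \<Rightarrow> bool"
  where "adjacent x y \<longleftrightarrow> x \<in> sites \<and> y \<in> sites \<and> l1_norm (x - y) = 1"

lemma adjacent_sym: "adjacent x y \<Longrightarrow> adjacent y x"
  by (simp add: adjacent_def l1_norm_minus_commute)

lemma bonds_eq: "bonds = {closed_segment x y | x y. adjacent x y}"
  by (auto simp: bonds_def adjacent_def)

lemma l1_norm_split: "l1_norm x = \<bar>x $ i\<bar> + (\<Sum>j \<in> UNIV - {i}. \<bar>x $ j\<bar>)"
  unfolding l1_norm_def by (rule sum.remove) auto

lemma adjacentE:
  assumes "adjacent x y"
  obtains i where "\<bar>x $ i - y $ i\<bar> = 1" "\<And>j. j \<noteq> i \<Longrightarrow> x $ j = y $ j"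
proof -
  have xy: "x \<in> sites" "y \<in> sites" "l1_norm (x - y) = 1" using assms by (auto simp: adjacent_def)
  have "x \<noteq> y" using xy(3) by auto
  then obtain i where i: "x $ i \<noteq> y $ i" by (auto simp: vec_eq_iff)
  have ge: "\<bar>x $ i - y $ i\<bar> \<ge> 1"
    using Ints_close_imp_eq[of "x $ i" "y $ i"] xy i by (force simp: sites_def)
  have eq: "1 = \<bar>x $ i - y $ i\<bar> + (\<Sum>j \<in> UNIV - {i}. \<bar>x $ j - y $ j\<bar>)"
    using l1_norm_split[of "x - y" i] xy by simp
  have "(\<Sum>j \<in> UNIV - {i}. \<bar>x $ j - y $ j\<bar>) \<ge> 0" by (simp add: sum_nonneg)
  then have "\<bar>x $ i - y $ i\<bar> = 1" "(\<Sum>j \<in> UNIV - {i}. \<bar>x $ j - y $ j\<bar>) = 0"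
    using ge eq by linarith+
  then show thesis by (intro that[of i]) (auto simp: sum_nonneg_eq_0_iff)
qed

text \<open>Exactly one coordinate changes, by 1, and consecutive integers have absolute values that
  differ by exactly 1. So every lattice step is strictly outward or strictly inward.\<close>

lemma adjacent_l1_norm:
  assumes "adjacent x y"
  shows "l1_norm y = l1_norm x + 1 \<or> l1_norm y = l1_norm x - 1"
proof -
  obtain i where i: "\<bar>x $ i - y $ i\<bar> = 1" "\<And>j. j \<noteq> i \<Longrightarrow> x $ j = y $ j"
    using adjacentE[OF assms] by blast
  have "(\<Sum>j \<in> UNIV - {i}. \<bar>x $ j\<bar>) = (\<Sum>j \<in> UNIV - {i}. \<bar>y $ j\<bar>)"
    using i by (intro sum.cong) auto
  then have "l1_norm y - l1_norm x = \<bar>y $ i\<bar> - \<bar>x $ i\<bar>"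
    using l1_norm_split[of x i] l1_norm_split[of y i] by simp
  moreover have "x $ i \<in> \<int>" "y $ i \<in> \<int>" using assms by (auto simp: adjacent_def sites_def)
  then have "\<bar>y $ i\<bar> - \<bar>x $ i\<bar> = 1 \<or> \<bar>y $ i\<bar> - \<bar>x $ i\<bar> = -1"
    using i(1) by (auto elim!: Ints_cases simp flip: of_int_diff of_int_abs)
  ultimately show ?thesis by linarith
qed

lemma l1_norm_le_max_segment:
  assumes "z \<in> closed_segment x y"
  shows "l1_norm z \<le> max (l1_norm x) (l1_norm y)"
proof -
  obtain u where u: "0 \<le> u" "u \<le> 1" "z = (1 - u) *\<^sub>R x + u *\<^sub>R y"
    using assms by (auto simp: in_segment)
  have "l1_norm z \<le> l1_norm ((1 - u) *\<^sub>R x) + l1_norm (u *\<^sub>R y)"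
    using u l1_norm_triangle by blast
  also have "\<dots> = (1 - u) * l1_norm x + u * l1_norm y"
    using u by (simp add: l1_norm_def abs_mult sum_distrib_left)
  also have "\<dots> \<le> max (l1_norm x) (l1_norm y)"
    using u by (intro convex_bound_le) auto
  finally show ?thesis .
qed

section \<open>Unit cubes centred at sites, their common faces, and the bonds that meet them\<close>

definition unit_cube :: "real ^ 3 \<Rightarrow> (real ^ 3) set"
  where "unit_cube x = {y. \<forall>i. \<bar>y $ i - x $ i\<bar> \<le> 1/2}"

lemma unit_cube_eq_cbox: "unit_cube x = cbox (x - (\<chi> i. 1/2)) (x + (\<chi> i. 1/2))"
proof -
  have "\<bar>a - b\<bar> \<le> 1/2 \<longleftrightarrow> b - 1/2 \<le> a \<and> a \<le> b + 1/2" for a b :: real by linarith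
  then show ?thesis by (simp add: unit_cube_def set_eq_iff mem_box_cart)
qed

lemma center_mem_unit_cube [simp]: "x \<in> unit_cube x"
  by (simp add: unit_cube_def)

lemma exists_unit_cube: "\<exists>y \<in> sites. x \<in> unit_cube y"
proof -
  have "\<bar>x $ i - of_int (round (x $ i))\<bar> \<le> 1/2" for i
    using of_int_round_abs_le[of "x $ i"] by (simp add: abs_minus_commute)
  then show ?thesis
    by (intro bexI[of _ "\<chi> i. of_int (round (x $ i))"]) (auto simp: unit_cube_def sites_def)
qed

lemma interior_unit_cube: "interior (unit_cube x) = {y. \<forall>i. \<bar>y $ i - x $ i\<bar> < 1/2}"
proof -
  have "interior (unit_cube x) = box (x - (\<chi> i. 1/2)) (x + (\<chi> i. 1/2))"
    by (simp add: unit_cube_eq_cbox interior_cbox)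
  also have "\<dots> = {y. \<forall>i. \<bar>y $ i - x $ i\<bar> < 1/2}"
  proof -
    have "\<bar>a - b\<bar> < 1/2 \<longleftrightarrow> b - 1/2 < a \<and> a < b + 1/2" for a b :: real by linarith
    then show ?thesis by (simp add: set_eq_iff mem_box_cart)
  qed
  finally show ?thesis .
qed

lemma closure_interior_unit_cube: "closure (interior (unit_cube x)) = unit_cube x"
proof -
  have "x \<in> interior (unit_cube x)" by (simp add: interior_unit_cube)
  then show ?thesis
    by (metis convex_closure_interior unit_cube_eq_cbox convex_box(1) closed_cbox closure_closed empty_iff)
qed

lemma mem_interior_unit_cube_unique:
  assumes "z \<in> interior (unit_cube x)" "z \<in> unit_cube y" "x \<in> sites" "y \<in> sites"
  shows "x = y"
proof (rule sites_close_imp_eq)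
  show "\<bar>x $ i - y $ i\<bar> < 1" for i
  proof -
    have "\<bar>z $ i - x $ i\<bar> < 1/2" "\<bar>z $ i - y $ i\<bar> \<le> 1/2"
      using assms(1,2) unfolding interior_unit_cube by (auto simp: unit_cube_def)
    then show ?thesis by linarith
  qed
qed (use assms in auto)

text \<open>The face property of cubes in one coordinate: intervals of radius 1/2 about distinct
  integers share at most an endpoint, and a proper convex combination of \<open>a\<close> and
  \<open>b\<close> reaches that endpoint only if \<open>a\<close> is already there.\<close>

lemma interval_face_aux:
  fixes a b x y u :: real
  assumes "x \<in> \<int>" "y \<in> \<int>" and u: "0 < u" "u < 1"
    and a: "\<bar>a - x\<bar> \<le> 1/2" and b: "\<bar>b - x\<bar> \<le> 1/2" and z: "\<bar>(1 - u) * a + u * b - y\<bar> \<le> 1/2"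
  shows "\<bar>a - y\<bar> \<le> 1/2"
proof -
  consider "x = y" | "x + 1 \<le> y" | "y + 1 \<le> x"
    using assms(1,2) by (auto elim!: Ints_cases) linarith
  then show ?thesis
  proof cases
    case 2
    \<comment> \<open>The gaps of \<open>a\<close> and \<open>b\<close> below the right end
      \<open>x + 1/2\<close> are nonnegative, but their weighted mean is at most 0 because
      \<open>y - 1/2\<close> is at least \<open>x + 1/2\<close>. So the gap of \<open>a\<close>
      vanishes.\<close>
    have "u * (x + 1/2 - b) \<ge> 0" "(1 - u) * (x + 1/2 - a) \<ge> 0" using a b u by (intro mult_nonneg_nonneg; linarith)+
    moreover have "(1 - u) * (x + 1/2 - a) + u * (x + 1/2 - b) = x + 1/2 - ((1 - u) * a + u * b)"
      by (simp add: field_simps)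
    ultimately have "(1 - u) * (x + 1/2 - a) = 0" "y = x + 1" using z 2 by linarith+
    then have "a = x + 1/2" using u by simp
    then show ?thesis using \<open>y = x + 1\<close> by simp
  next
    case 3
    have "u * (b - (x - 1/2)) \<ge> 0" "(1 - u) * (a - (x - 1/2)) \<ge> 0" using a b u by (intro mult_nonneg_nonneg; linarith)+
    moreover have "(1 - u) * (a - (x - 1/2)) + u * (b - (x - 1/2)) = ((1 - u) * a + u * b) - (x - 1/2)"
      by (simp add: field_simps)
    ultimately have "(1 - u) * (a - (x - 1/2)) = 0" "x = y + 1" using z 3 by linarith+
    then have "a = x - 1/2" using u by simp
    then show ?thesis using \<open>x = y + 1\<close> by simp
  qed (use a in simp)
qed

text \<open>Convex combinations are formed coordinatewise, so \<open>interval_face_aux\<close>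
  settles each coordinate. This is what makes the cubes at sites fit together as a cell
  complex.\<close>

lemma unit_cube_Int_face:
  assumes "x \<in> sites" "y \<in> sites"
  shows "unit_cube x \<inter> unit_cube y face_of unit_cube x"
  unfolding face_of_def
proof (intro conjI ballI impI)
  show "convex (unit_cube x \<inter> unit_cube y)"
    by (simp add: unit_cube_eq_cbox convex_Int convex_box)
next
  have *: "a \<in> unit_cube y"
    if "a \<in> unit_cube x" "b \<in> unit_cube x" "z \<in> unit_cube y" and z: "z \<in> open_segment a b" for a b z
  proof -
    obtain u where u: "0 < u" "u < 1" "z = (1 - u) *\<^sub>R a + u *\<^sub>R b"
      using z by (auto simp: in_segment)
    have "\<bar>a $ i - y $ i\<bar> \<le> 1/2" for i
      using that(1-3) assms u unfolding unit_cube_def sites_def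
      by (intro interval_face_aux[of "x $ i" "y $ i" u "a $ i" "b $ i"]) simp_all
    then show ?thesis by (simp add: unit_cube_def)
  qed
  fix a b z assume "a \<in> unit_cube x" "b \<in> unit_cube x" "z \<in> unit_cube x \<inter> unit_cube y"
    and "z \<in> open_segment a b"
  then show "a \<in> unit_cube x \<inter> unit_cube y" "b \<in> unit_cube x \<inter> unit_cube y"
    using *[of a b z] *[of b a z] by (auto simp: open_segment_commute)
qed auto

text \<open>Off its direction \<open>i\<close> the segment has constant integer coordinates, so
  \<open>w\<close> agrees with both ends there. Along \<open>i\<close>, an integer within 1/2 of a
  point between two consecutive integers is one of these two.\<close>

lemma segment_Int_unit_cube:
  assumes "adjacent x y" "z \<in> closed_segment x y" "z \<in> unit_cube w" "w \<in> sites"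
  shows "w = x \<or> w = y"
proof -
  obtain i where i: "\<bar>x $ i - y $ i\<bar> = 1" "\<And>j. j \<noteq> i \<Longrightarrow> x $ j = y $ j"
    using adjacentE[OF assms(1)] by blast
  obtain u where u: "0 \<le> u" "u \<le> 1" "z = (1 - u) *\<^sub>R x + u *\<^sub>R y"
    using assms(2) by (auto simp: in_segment)
  have ints: "x $ j \<in> \<int>" "y $ j \<in> \<int>" "w $ j \<in> \<int>" for j
    using assms by (auto simp: adjacent_def sites_def)
  have zw: "\<bar>z $ j - w $ j\<bar> \<le> 1/2" for j using assms(3) by (simp add: unit_cube_def)
  have other: "w $ j = x $ j" "w $ j = y $ j" if "j \<noteq> i" for j
  proof -
    have "z $ j = (1 - u) * x $ j + u * y $ j" using u by simp
    then have "z $ j = x $ j" using i(2)[OF that] by (simp add: algebra_simps)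
    then have "\<bar>w $ j - x $ j\<bar> < 1" using zw[of j] by linarith
    then show "w $ j = x $ j" using ints Ints_close_imp_eq by blast
    then show "w $ j = y $ j" using i(2)[OF that] by simp
  qed
  have "z $ i = (1 - u) * x $ i + u * y $ i" using u by simp
  then have "z $ i = x $ i + u * (y $ i - x $ i)" by (simp add: algebra_simps)
  moreover have "y $ i - x $ i = 1 \<or> y $ i - x $ i = -1" using i(1) by linarith
  ultimately have "\<bar>w $ i - x $ i\<bar> < 1 \<or> \<bar>w $ i - y $ i\<bar> < 1"
    using zw[of i] u by (auto simp: abs_if split: if_splits)
  then have "w $ i = x $ i \<or> w $ i = y $ i" using ints Ints_close_imp_eq by blast
  then show ?thesis using other unfolding vec_eq_iff by metis
qed

section \<open>Unions of cubes over down-closed sets of sites\<close>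

text \<open>One coordinate of the star-shapedness of the body: rounding \<open>v\<close> towards 0
  gives an integer that does not pass \<open>x\<close>, and near 0 the integer 0 serves.\<close>

lemma interval_star_aux:
  fixes v x z :: real
  assumes "x \<in> \<int>" "\<bar>z - x\<bar> \<le> 1/2" "\<bar>v\<bar> < 1/2 \<or> \<bar>v\<bar> < \<bar>z\<bar> \<and> v * z > 0"
  shows "\<exists>y \<in> \<int>. \<bar>v - y\<bar> \<le> 1/2 \<and> \<bar>y\<bar> \<le> \<bar>x\<bar> \<and> 0 \<le> x * y"
proof (cases "\<bar>v\<bar> \<le> 1/2")
  case True
  then show ?thesis by (intro bexI[of _ 0]) auto
next
  case False
  then have v: "\<bar>v\<bar> < \<bar>z\<bar>" "v * z > 0" using assms(3) by auto
  obtain n where n: "x = of_int n" using assms(1) by (auto elim: Ints_cases)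
  consider "v > 1/2" "z > v" | "v < -1/2" "z < v"
    using False v unfolding zero_less_mult_iff by linarith
  then show ?thesis
  proof cases
    case 1
    \<comment> \<open>The least integer within 1/2 of \<open>v\<close>. As
      \<open>v - 1/2 < z - 1/2 \<le> n\<close>, it cannot exceed \<open>n\<close>. The floor in the
      other case is the mirror image.\<close>
    define m where "m = \<lceil>v - 1/2\<rceil>"
    have "m \<ge> 0" "m \<le> n" using 1 assms(2) n unfolding m_def by linarith+
    moreover have "\<bar>v - of_int m\<bar> \<le> 1/2" unfolding m_def by linarith
    ultimately show ?thesis using n by (intro bexI[of _ "of_int m"]) auto
  next
    case 2
    define m where "m = \<lfloor>v + 1/2\<rfloor>"
    have "m \<le> 0" "n \<le> m" using 2 assms(2) n unfolding m_def by linarith+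
    moreover have "\<bar>v - of_int m\<bar> \<le> 1/2" unfolding m_def by linarith
    ultimately show ?thesis using n
      by (intro bexI[of _ "of_int m"]) (auto simp: mult_nonpos_nonpos)
  qed
qed

text \<open>In the last condition \<open>y\<close> ranges over the sites of the box with opposite
  corners 0 and \<open>x\<close>.\<close>

locale down_closed_sites =
  fixes R :: "(real ^ 3) set"
  assumes R_sites: "R \<subseteq> sites" and finite_R: "finite R" and zero_mem_R: "0 \<in> R"
    and down_closed: "\<lbrakk>x \<in> R; y \<in> sites; \<And>i. \<bar>y $ i\<bar> \<le> \<bar>x $ i\<bar> \<and> 0 \<le> x $ i * y $ i\<rbrakk> \<Longrightarrow> y \<in> R"
begin

definition body :: "(real ^ 3) set"
  where "body = (\<Union>x\<in>R. unit_cube x)"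

lemma compact_body: "compact body"
  unfolding body_def unit_cube_eq_cbox using finite_R by (intro compact_UN) auto

lemma site_mem_body: "x \<in> sites \<Longrightarrow> x \<in> body \<longleftrightarrow> x \<in> R"
proof
  assume x: "x \<in> sites" "x \<in> body"
  then obtain y where "y \<in> R" "x \<in> unit_cube y" by (auto simp: body_def)
  then have "x = y"
    using x R_sites mem_interior_unit_cube_unique[of x x y] by (auto simp: interior_unit_cube)
  then show "x \<in> R" using \<open>y \<in> R\<close> by simp
qed (auto simp: body_def intro: center_mem_unit_cube)

text \<open>Strict star-shapedness about 0. The integers that \<open>interval_star_aux\<close> finds
  in the separate coordinates form a site, which \<open>down_closed\<close> puts into
  \<open>R\<close>.\<close>

lemma scaled_mem_interior_body:
  assumes "z \<in> body" "0 \<le> u" "u < 1"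
  shows "u *\<^sub>R z \<in> interior body"
proof -
  obtain x where x: "x \<in> R" "z \<in> unit_cube x" using assms(1) by (auto simp: body_def)
  \<comment> \<open>An open neighbourhood of the scaled point. The first alternative serves the
    coordinates whose scaled value is 0, where the strict condition on the product fails.\<close>
  define V where "V = (\<Inter>i. {v :: real ^ 3. \<bar>v $ i\<bar> < 1/2} \<union>
    ({v. \<bar>v $ i\<bar> < \<bar>z $ i\<bar>} \<inter> {v. v $ i * z $ i > 0}))"
  show ?thesis
  proof (rule interiorI)
    show "open V"
      unfolding V_def by (intro open_INT ballI open_Un open_Int open_Collect_less continuous_intros) auto
    show "u *\<^sub>R z \<in> V"
    proof -
      have "\<bar>u * a\<bar> < \<bar>a\<bar> \<and> u * a * a > 0" if "\<bar>u * a\<bar> \<ge> 1/2" for a :: real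
      proof -
        have "u > 0" "a \<noteq> 0" using that assms by (auto simp: less_le)
        then have "a * a > 0" using not_real_square_gt_zero[of a] by blast
        then have "u * (a * a) > 0" using \<open>u > 0\<close> by simp
        moreover have "u * \<bar>a\<bar> < 1 * \<bar>a\<bar>"
          using assms(3) \<open>a \<noteq> 0\<close> by (intro mult_strict_right_mono) auto
        ultimately show ?thesis using assms by (simp add: abs_mult mult.assoc)
      qed
      then have "\<bar>u * z $ i\<bar> < 1/2 \<or> \<bar>u * z $ i\<bar> < \<bar>z $ i\<bar> \<and> u * z $ i * z $ i > 0" for i
        using not_less by blast
      then show ?thesis unfolding V_def by simp
    qed
    show "V \<subseteq> body"
    proof
      fix v assume v: "v \<in> V"
      have "\<exists>y \<in> \<int>. \<bar>v $ i - y\<bar> \<le> 1/2 \<and> \<bar>y\<bar> \<le> \<bar>x $ i\<bar> \<and> 0 \<le> x $ i * y" for i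
      proof (rule interval_star_aux)
        show "x $ i \<in> \<int>" using x R_sites by (auto simp: sites_def)
        show "\<bar>z $ i - x $ i\<bar> \<le> 1/2" using x by (simp add: unit_cube_def)
        show "\<bar>v $ i\<bar> < 1/2 \<or> \<bar>v $ i\<bar> < \<bar>z $ i\<bar> \<and> v $ i * z $ i > 0" using v by (auto simp: V_def)
      qed
      then obtain f where f: "\<And>i. f i \<in> \<int> \<and> \<bar>v $ i - f i\<bar> \<le> 1/2 \<and> \<bar>f i\<bar> \<le> \<bar>x $ i\<bar> \<and> 0 \<le> x $ i * f i"
        by metis
      then have "vec_lambda f \<in> R" by (intro down_closed[OF x(1)]) (auto simp: sites_def)
      moreover have "v \<in> unit_cube (vec_lambda f)" using f by (simp add: unit_cube_def)
      ultimately show "v \<in> body" by (auto simp: body_def)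
    qed
  qed
qed

section \<open>The frontier of the body as a polyhedral sphere\<close>

lemma zero_mem_interior_body: "0 \<in> interior body"
  using scaled_mem_interior_body[of 0 0] zero_mem_R site_mem_body[of 0] by simp

text \<open>Radial projection from 0. The projection theorem speaks of relative interiors; with 0 in
  the interior of the body these are ordinary interiors, and the affine hull is the whole
  space.\<close>

lemma frontier_body_homeomorphic_sphere: "frontier body homeomorphic sphere (0 :: real ^ 3) 1"
proof -
  have hull: "affine hull body = UNIV"
    using zero_mem_interior_body by (intro affine_hull_nonempty_interior) auto
  have ri: "rel_interior body = interior body"
    using zero_mem_interior_body by (intro rel_interior_nonempty_interior) auto
  have "body - rel_interior body homeomorphic sphere 0 1 \<inter> affine hull body"
  proof (rule starlike_compact_projective1_0[OF compact_body])
    show "0 \<in> rel_interior body" using zero_mem_interior_body ri by simp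
    show "open_segment 0 x \<subseteq> rel_interior body" if "x \<in> body" for x
      using scaled_mem_interior_body[OF that] unfolding ri by (auto simp: in_segment)
  qed
  then show ?thesis
    using compact_body by (simp add: hull ri frontier_def compact_imp_closed)
qed

text \<open>The cubes cover space in a locally finite way, so a frontier point also lies in a cube
  outside \<open>R\<close>; conversely, the interior of such a cube misses the body. This exhibits
  the frontier as a union of cells.\<close>

lemma frontier_body: "frontier body = (\<Union>x\<in>R. \<Union>y\<in>sites - R. unit_cube x \<inter> unit_cube y)"
proof (intro subset_antisym subsetI)
  fix z assume z: "z \<in> frontier body"
  then have "z \<in> body" using compact_body frontier_subset_compact by blast
  moreover have "\<exists>y \<in> sites - R. z \<in> unit_cube y"
  proof (rule ccontr)
    assume none: "\<not> (\<exists>y \<in> sites - R. z \<in> unit_cube y)"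
    \<comment> \<open>\<open>B\<close> contains every site outside \<open>R\<close> whose cube can
      meet the open unit cube about \<open>z\<close>: two displacements of at most 1/2 add up to the
      1. Removing these finitely many closed cubes leaves an open set.\<close>
    define B where "B = {y \<in> sites. \<forall>i. \<bar>y $ i\<bar> \<le> l1_norm z + 1} - R"
    define V where "V = interior (unit_cube z) - (\<Union>y\<in>B. unit_cube y)"
    have "finite B" unfolding B_def using finite_sites_bounded by simp
    then have "open V"
      unfolding V_def unit_cube_eq_cbox by (intro open_Diff closed_UN open_interior) auto
    moreover have "z \<in> V" using none by (auto simp: V_def B_def interior_unit_cube)
    moreover have "V \<subseteq> body"
    proof
      fix v assume v: "v \<in> V"
      obtain y where y: "y \<in> sites" "v \<in> unit_cube y" using exists_unit_cube by blast
      have "\<bar>y $ i\<bar> \<le> l1_norm z + 1" for i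
      proof -
        have "\<bar>v $ i - z $ i\<bar> < 1/2" using v by (simp add: V_def interior_unit_cube)
        moreover have "\<bar>v $ i - y $ i\<bar> \<le> 1/2" using y by (simp add: unit_cube_def)
        ultimately show ?thesis using abs_nth_le_l1_norm[of z i] by linarith
      qed
      then have "y \<in> R" using y v by (auto simp: V_def B_def)
      then show "v \<in> body" using y by (auto simp: body_def)
    qed
    ultimately have "z \<in> interior body" by (rule interiorI)
    then show False using z by (simp add: frontier_def)
  qed
  ultimately show "z \<in> (\<Union>x\<in>R. \<Union>y\<in>sites - R. unit_cube x \<inter> unit_cube y)"
    by (auto simp: body_def)
next
  fix z assume "z \<in> (\<Union>x\<in>R. \<Union>y\<in>sites - R. unit_cube x \<inter> unit_cube y)"
  then obtain x y where xy: "x \<in> R" "y \<in> sites - R" "z \<in> unit_cube x" "z \<in> unit_cube y" by blast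
  have disj: "interior body \<inter> interior (unit_cube y) = {}"
  proof (rule ccontr)
    assume "interior body \<inter> interior (unit_cube y) \<noteq> {}"
    then obtain v where v: "v \<in> body" "v \<in> interior (unit_cube y)"
      using interior_subset by blast
    then obtain w where w: "w \<in> R" "v \<in> unit_cube w" by (auto simp: body_def)
    then have "y = w" using mem_interior_unit_cube_unique[OF v(2) w(2)] xy R_sites by blast
    then show False using w xy by simp
  qed
  \<comment> \<open>An open set that misses the open cube also misses its closure, the closed
    cube.\<close>
  have "interior body \<inter> unit_cube y = {}"
    using disj open_Int_closure_eq_empty[of "interior body" "interior (unit_cube y)"]
    by (simp add: closure_interior_unit_cube)
  moreover have "z \<in> body" using xy by (auto simp: body_def)
  ultimately show "z \<in> frontier body"
    using xy closure_subset unfolding frontier_def by fast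
qed

text \<open>The intersections of cubes form a finite complex of polytopes, and a simplicial
  subdivision of it triangulates the frontier.\<close>

lemma polyhedral_sphere_frontier_body: "polyhedral_sphere (frontier body)"
proof -
  \<comment> \<open>Cubes that meet have centres within 1 of each other in every coordinate, so
    \<open>N\<close> contains all centres that contribute to the frontier. Restricting to
    \<open>N\<close> makes the complex finite.\<close>
  define N where "N = {y \<in> sites. \<forall>i. \<bar>y $ i\<bar> \<le> Max (l1_norm ` R) + 1}"
  have "N \<subseteq> sites" by (auto simp: N_def)
  define M where "M = (\<lambda>(x, y). unit_cube x \<inter> unit_cube y) ` (R \<times> (N - R))"
  have "finite M"
    unfolding M_def N_def using finite_R finite_sites_bounded by auto
  moreover have "polytope C" if "C \<in> M" for C
    using that by (auto simp: M_def unit_cube_eq_cbox intro!: polytope_Int polytope_interval)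
  moreover have "C \<inter> D face_of C" if CD: "C \<in> M" "D \<in> M" for C D
  proof -
    obtain x y x' y' where C: "C = unit_cube x \<inter> unit_cube y" and D: "D = unit_cube x' \<inter> unit_cube y'"
      and s: "x \<in> sites" "y \<in> sites" "x' \<in> sites" "y' \<in> sites"
    proof -
      have "\<exists>x y. E = unit_cube x \<inter> unit_cube y \<and> x \<in> sites \<and> y \<in> sites" if "E \<in> M" for E
        using that R_sites unfolding M_def N_def by auto
      then show thesis using CD that by metis
    qed
    \<comment> \<open>Rearranged, \<open>C \<inter> D\<close> is the intersection of one face from
      each of the two cubes that define \<open>C\<close>.\<close>
    have "(unit_cube x \<inter> unit_cube x') \<inter> (unit_cube y \<inter> unit_cube y') face_of C"
      unfolding C using s by (intro face_of_Int_Int unit_cube_Int_face)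
    then show ?thesis by (simp add: C D Int_ac)
  qed
  ultimately obtain T where T: "simplicial_complex T" "\<Union> T = \<Union> M"
    using simplicial_subdivision_of_cell_complex by metis
  have "\<Union> M = frontier body"
  proof -
    have "y \<in> N" if xy: "x \<in> R" "y \<in> sites" "z \<in> unit_cube x" "z \<in> unit_cube y" for x y z
    proof -
      have "l1_norm x \<le> Max (l1_norm ` R)" using xy finite_R by simp
      moreover have "\<bar>y $ i\<bar> \<le> l1_norm x + 1" for i
      proof -
        have "\<bar>z $ i - x $ i\<bar> \<le> 1/2" "\<bar>z $ i - y $ i\<bar> \<le> 1/2"
          using xy by (auto simp: unit_cube_def)
        then show ?thesis using abs_nth_le_l1_norm[of x i] by linarith
      qed
      ultimately have "\<bar>y $ i\<bar> \<le> Max (l1_norm ` R) + 1" for i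
        by (meson add_right_mono order_trans)
      then show ?thesis using xy by (simp add: N_def)
    qed
    then have "(\<Union>x\<in>R. \<Union>y\<in>N - R. unit_cube x \<inter> unit_cube y)
        = (\<Union>x\<in>R. \<Union>y\<in>sites - R. unit_cube x \<inter> unit_cube y)"
      using \<open>N \<subseteq> sites\<close> by blast
    moreover have "\<Union> M = (\<Union>x\<in>R. \<Union>y\<in>N - R. unit_cube x \<inter> unit_cube y)"
      unfolding M_def by fastforce
    ultimately show ?thesis using frontier_body by simp
  qed
  then show ?thesis
    unfolding polyhedral_sphere_def using T frontier_body_homeomorphic_sphere by metis
qed

section \<open>Inside and outside of the frontier, and entangled sets at the origin\<close>

lemma zero_mem_inside_frontier_body: "0 \<in> inside (frontier body)"
proof -
  have 0: "0 \<notin> frontier body" using zero_mem_interior_body by (simp add: frontier_def)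
  \<comment> \<open>A connected set that contains 0 and leaves the body must meet the frontier, so
    the component of 0 is as bounded as the body.\<close>
  have "connected_component_set (- frontier body) 0 \<subseteq> body"
  proof (rule ccontr)
    let ?C = "connected_component_set (- frontier body) 0"
    assume "\<not> ?C \<subseteq> body"
    moreover have "0 \<in> ?C \<inter> body"
      using 0 zero_mem_interior_body interior_subset by (auto simp: connected_component_refl_eq)
    ultimately have "?C \<inter> frontier body \<noteq> {}"
      by (intro connected_Int_frontier connected_connected_component) blast+
    then show False using connected_component_subset by blast
  qed
  then show ?thesis
    using 0 compact_body by (auto simp: inside_def intro: bounded_subset compact_imp_bounded)
qed

text \<open>The ray from \<open>y\<close> away from 0 is connected, unbounded and misses the body:
  by star-shapedness, a point of it in the body would bring \<open>y\<close> into the body as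
  well.\<close>

lemma mem_outside_frontier_body:
  assumes "y \<notin> body"
  shows "y \<in> outside (frontier body)"
proof -
  define L where "L = (\<lambda>t. t *\<^sub>R y) ` {1..}"
  have y0: "y \<noteq> 0" using assms zero_mem_interior_body interior_subset by auto
  have disj: "L \<inter> body = {}"
  proof (rule ccontr)
    assume "L \<inter> body \<noteq> {}"
    then obtain t where t: "t \<ge> 1" "t *\<^sub>R y \<in> body" by (auto simp: L_def)
    show False
    proof (cases "t = 1")
      case False
      then have "(1 / t) *\<^sub>R t *\<^sub>R y \<in> interior body" using t by (intro scaled_mem_interior_body) auto
      then show False using t assms interior_subset by auto
    qed (use t assms in simp)
  qed
  have "frontier body \<subseteq> body" using compact_body by (simp add: frontier_subset_compact)
  then have "L \<subseteq> - frontier body" using disj by blast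
  moreover have "connected L" unfolding L_def by (intro connected_continuous_image continuous_intros) auto
  moreover have "y \<in> L" unfolding L_def by (intro image_eqI[of _ _ 1]) auto
  ultimately have "L \<subseteq> connected_component_set (- frontier body) y"
    by (intro connected_component_maximal)
  moreover have "\<not> bounded L"
  proof
    assume "bounded L"
    then obtain B where B: "\<And>x. x \<in> L \<Longrightarrow> norm x \<le> B" by (auto simp: bounded_iff)
    define t where "t = max 1 ((B + 1) / norm y)"
    have "t *\<^sub>R y \<in> L" by (auto simp: L_def t_def)
    then have "t * norm y \<le> B" using B[of "t *\<^sub>R y"] by (simp add: t_def)
    moreover have "(B + 1) / norm y * norm y \<le> t * norm y" by (intro mult_right_mono) (auto simp: t_def)
    ultimately show False using y0 by simp
  qed
  ultimately show ?thesis
    using \<open>y \<in> L\<close> \<open>L \<subseteq> - frontier body\<close> by (auto simp: outside_def intro: bounded_subset)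
qed

lemma one_entangled_segmentE:
  assumes "one_entangled K" "e \<in> K"
  obtains x y where "e = closed_segment x y" "adjacent x y"
proof -
  have "e \<in> bonds" using assms unfolding one_entangled_def by blast
  then show thesis using that unfolding bonds_eq by blast
qed

text \<open>A frontier point on the bond would lie in a cube of \<open>R\<close> and in one outside
  \<open>R\<close>, and both cubes would have to be centred at ends of the bond.\<close>

lemma segment_Int_frontier_body:
  assumes "adjacent x y" "x \<in> R \<longleftrightarrow> y \<in> R"
  shows "closed_segment x y \<inter> frontier body = {}"
proof (rule ccontr)
  assume "closed_segment x y \<inter> frontier body \<noteq> {}"
  then obtain z v w where z: "z \<in> closed_segment x y" "v \<in> R" "w \<in> sites - R" "z \<in> unit_cube v" "z \<in> unit_cube w"
    unfolding frontier_body by blast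
  then have "v = x \<or> v = y" "w = x \<or> w = y"
    using segment_Int_unit_cube[OF assms(1) z(1)] R_sites by blast+
  then show False using z assms(2) by auto
qed

text \<open>Otherwise the frontier would separate the point set of \<open>K\<close>: 0 is inside, a
  point off the body is outside, and by \<open>same\<close> no bond of \<open>K\<close> meets the
  frontier.\<close>

lemma one_entangled_subset_body:
  assumes K: "one_entangled K" "0 \<in> \<Union> K"
    and same: "\<And>x y. \<lbrakk>adjacent x y; closed_segment x y \<in> K\<rbrakk> \<Longrightarrow> x \<in> R \<longleftrightarrow> y \<in> R"
  shows "\<Union> K \<subseteq> body"
proof (rule ccontr)
  assume "\<not> \<Union> K \<subseteq> body"
  then obtain y where "y \<in> \<Union> K" "y \<notin> body" by blast
  then have "\<Union> K \<inter> outside (frontier body) \<noteq> {}" using mem_outside_frontier_body by blast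
  moreover have "\<Union> K \<inter> inside (frontier body) \<noteq> {}"
    using K(2) zero_mem_inside_frontier_body by blast
  moreover have "e \<inter> frontier body = {}" if e: "e \<in> K" for e
  proof -
    obtain x y where "e = closed_segment x y" "adjacent x y"
      by (rule one_entangled_segmentE[OF K(1) e])
    then show ?thesis using segment_Int_frontier_body[of x y] same[of x y] e by metis
  qed
  then have "\<Union> K \<inter> frontier body = {}" by blast
  ultimately have "separates (frontier body) (\<Union> K)" by (simp add: separates_def)
  then show False using K(1) polyhedral_sphere_frontier_body by (auto simp: one_entangled_def)
qed

lemma one_entangled_endsE:
  assumes "one_entangled K" "\<Union> K \<subseteq> body" "e \<in> K"
  obtains x y where "e = closed_segment x y" "x \<in> R" "y \<in> R"
proof -
  obtain x y where xy: "e = closed_segment x y" "adjacent x y"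
    by (rule one_entangled_segmentE[OF assms(1,3)])
  then have "x \<in> e" "y \<in> e" by simp_all
  then have "x \<in> body" "y \<in> body" using assms(2,3) by blast+
  moreover have "x \<in> sites" "y \<in> sites" using xy(2) unfolding adjacent_def by blast+
  ultimately show thesis using that[OF xy(1)] site_mem_body by blast
qed

lemma one_entangled_finite:
  assumes "one_entangled K" "\<Union> K \<subseteq> body"
  shows "finite K"
proof (rule finite_subset)
  show "K \<subseteq> (\<lambda>(x, y). closed_segment x y) ` (R \<times> R)"
  proof
    fix e assume "e \<in> K"
    then obtain x y where xy: "e = closed_segment x y" "x \<in> R" "y \<in> R"
      by (rule one_entangled_endsE[OF assms])
    show "e \<in> (\<lambda>(x, y). closed_segment x y) ` (R \<times> R)"
      unfolding xy(1) using xy(2,3) by (intro image_eqI[where x = "(x, y)"]) simp_all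
  qed
  show "finite ((\<lambda>(x, y). closed_segment x y) ` (R \<times> R))" using finite_R by simp
qed

lemma rad_le_Max:
  assumes "one_entangled K" "\<Union> K \<subseteq> body"
  shows "rad (\<Union> K) \<le> ennreal (Max (l1_norm ` R))"
  unfolding rad_def
proof (rule SUP_least)
  fix z assume "z \<in> \<Union> K"
  then obtain e where e: "e \<in> K" "z \<in> e" by blast
  obtain x y where xy: "e = closed_segment x y" "x \<in> R" "y \<in> R"
    by (rule one_entangled_endsE[OF assms e(1)])
  then have "l1_norm x \<le> Max (l1_norm ` R)" "l1_norm y \<le> Max (l1_norm ` R)"
    using finite_R by simp_all
  then have "l1_norm z \<le> Max (l1_norm ` R)"
    using l1_norm_le_max_segment[of z x y] e(2) unfolding xy(1) by linarith
  then show "ennreal (l1_norm z) \<le> ennreal (Max (l1_norm ` R))" by (rule ennreal_leI)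
qed

end

section \<open>The connective constant\<close>

text \<open>Fekete's lemma in multiplicative form.\<close>

lemma convergent_root_submultiplicative:
  fixes c :: "nat \<Rightarrow> real"
  assumes ge1: "\<And>k. c k \<ge> 1" and submult: "\<And>m n. c (m + n) \<le> c m * c n"
  shows "convergent (\<lambda>k. root k (c k))"
proof -
  \<comment> \<open>The index 0 is left out because \<open>root 0\<close> is constantly 0.\<close>
  define L where "L = (INF k\<in>{1..}. root k (c k))"
  have root_ge1: "root k (c k) \<ge> 1" if "k \<ge> 1" for k using ge1 that by simp
  have bdd: "bdd_below ((\<lambda>k. root k (c k)) ` {1..})"
    using root_ge1 by (intro bdd_belowI2[of _ 1]) auto
  have "(\<lambda>k. root k (c k)) \<longlonglongrightarrow> L"
  proof (rule order_tendstoI)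
    fix a assume "a < L"
    have "L \<le> root k (c k)" if "k \<ge> 1" for k
      unfolding L_def using bdd that by (intro cINF_lower) auto
    then show "\<forall>\<^sub>F k in sequentially. a < root k (c k)"
      using \<open>a < L\<close> by (intro eventually_sequentiallyI[of 1]) (meson less_le_trans)
  next
    fix a assume "L < a"
    then obtain b where b: "L < b" "b < a" using dense by blast
    have "\<exists>m\<in>{1..}. root m (c m) < b"
      using cINF_less_iff[OF _ bdd, of b] b(1) unfolding L_def by auto
    then obtain m where m: "m \<ge> 1" "root m (c m) < b" by auto
    have b1: "b \<ge> 1" using root_ge1[OF m(1)] m(2) by linarith
    have "c m = root m (c m) ^ m" using m(1) ge1[of m] by simp
    also have "\<dots> \<le> b ^ m" using m root_ge1[OF m(1)] by (intro power_mono) auto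
    finally have cm: "c m \<le> b ^ m" .
    \<comment> \<open>Blocks of length \<open>m\<close> are split off one at a time;
      \<open>r\<close> later becomes the remainder modulo \<open>m\<close>.\<close>
    have mult: "c (m * q + r) \<le> c m ^ q * c r" for q r
    proof (induction q)
      case (Suc q)
      have "c (m * Suc q + r) \<le> c m * c (m * q + r)"
        using submult[of m "m * q + r"] by (simp add: algebra_simps)
      also have "\<dots> \<le> c m * (c m ^ q * c r)"
        using Suc ge1[of m] by (intro mult_left_mono) auto
      finally show ?case by (simp add: mult.assoc)
    qed simp
    define A where "A = Max (c ` {..m})"
    have cA: "c r \<le> A" if "r \<le> m" for r unfolding A_def using that by simp
    have A1: "A \<ge> 1" using cA[of 0] ge1[of 0] by linarith
    have bound: "c k \<le> A * b ^ k" for k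
    proof -
      have "c k = c (m * (k div m) + k mod m)" by simp
      also have "\<dots> \<le> c m ^ (k div m) * c (k mod m)" by (rule mult)
      also have "\<dots> \<le> (b ^ m) ^ (k div m) * A"
        using cm ge1[of m] ge1[of "k mod m"] m(1) b1 order.strict_implies_order[OF mod_less_divisor[of m k]]
        by (intro mult_mono power_mono cA) auto
      also have "\<dots> \<le> b ^ k * A"
        unfolding power_mult[symmetric] using b1 A1 by (intro mult_right_mono power_increasing) auto
      finally show ?thesis by (simp add: mult.commute)
    qed
    \<comment> \<open>The constant factor \<open>A\<close> disappears in the limit, since its
      \<open>k\<close>-th root tends to 1.\<close>
    have "(\<lambda>k. root k A * b) \<longlonglongrightarrow> 1 * b"
      using A1 by (intro tendsto_intros LIMSEQ_root_const) auto
    then have "\<forall>\<^sub>F k in sequentially. root k A * b < a"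
      using b(2) by (intro order_tendstoD(2)) auto
    then show "\<forall>\<^sub>F k in sequentially. root k (c k) < a"
      using eventually_ge_at_top[of 1]
    proof eventually_elim
      case (elim k)
      have "root k (c k) \<le> root k (A * b ^ k)" using bound elim by simp
      also have "\<dots> = root k A * b" using elim b1 by (simp add: real_root_mult real_root_power_cancel)
      finally show ?case using elim by linarith
    qed
  qed
  then show ?thesis by (rule convergentI)
qed

section \<open>Counts of self-avoiding paths and their growth\<close>

lemma self_avoiding_paths_l1_norm_le:
  assumes "xs \<in> self_avoiding_paths k" "i \<le> k"
  shows "l1_norm (xs ! i) \<le> real i"
  using assms(2)
proof (induction i)
  case 0
  have "xs \<noteq> []" "hd xs = 0" using assms(1) by (auto simp: self_avoiding_paths_def)
  then show ?case by (simp add: hd_conv_nth)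
next
  case (Suc i)
  have "l1_norm (xs ! Suc i) \<le> l1_norm (xs ! Suc i - xs ! i) + l1_norm (xs ! i)"
    using l1_norm_triangle[of "xs ! Suc i - xs ! i" "xs ! i"] by simp
  then show ?case using Suc assms(1) by (simp add: self_avoiding_paths_def)
qed

lemma finite_self_avoiding_paths: "finite (self_avoiding_paths k)"
proof (rule finite_subset)
  let ?S = "{x \<in> sites. \<forall>i. \<bar>x $ i\<bar> \<le> real k}"
  show "self_avoiding_paths k \<subseteq> {xs. set xs \<subseteq> ?S \<and> length xs = Suc k}"
  proof clarify
    fix xs assume xs: "xs \<in> self_avoiding_paths k"
    have len: "length xs = Suc k" using xs by (simp add: self_avoiding_paths_def)
    have "\<bar>x $ j\<bar> \<le> real k" if x: "x \<in> set xs" for x j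
    proof -
      obtain i where i: "i \<le> k" "x = xs ! i"
        using x len by (metis in_set_conv_nth less_Suc_eq_le)
      then show ?thesis using self_avoiding_paths_l1_norm_le[OF xs i(1)] abs_nth_le_l1_norm[of x j] by simp
    qed
    then show "set xs \<subseteq> ?S \<and> length xs = Suc k" using xs len unfolding self_avoiding_paths_def by blast
  qed
  show "finite {xs. set xs \<subseteq> ?S \<and> length xs = Suc k}"
    by (intro finite_lists_length_eq finite_sites_bounded)
qed

lemma card_self_avoiding_paths_ge_1: "card (self_avoiding_paths k) \<ge> 1"
proof -
  let ?xs = "map (\<lambda>i. axis 1 (real i) :: real ^ 3) [0..<Suc k]"
  have "?xs \<in> self_avoiding_paths k"
  proof -
    have "axis 1 (real (Suc i)) - axis 1 (real i) = (axis 1 1 :: real ^ 3)" for i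
      by (simp add: axis_def vec_eq_iff)
    moreover have "l1_norm (axis 1 1) = 1"
      by (subst l1_norm_split[of _ 1]) (simp add: axis_def)
    moreover have "distinct ?xs" by (auto simp: distinct_map inj_on_def axis_eq_axis simp del: upt_Suc)
    moreover have "hd ?xs = 0" by (simp add: hd_map axis_def vec_eq_iff del: upt_Suc)
    moreover have "set ?xs \<subseteq> sites" by (auto simp: sites_def axis_def)
    ultimately show ?thesis by (simp add: self_avoiding_paths_def nth_append del: upt_Suc)
  qed
  then show ?thesis
    using finite_self_avoiding_paths by (auto simp: Suc_le_eq card_gt_0_iff)
qed

text \<open>A path is cut at its vertex \<open>m\<close> and the second part is translated to start
  at 0; the two parts determine the path.\<close>

lemma card_self_avoiding_paths_add:
  "card (self_avoiding_paths (m + n)) \<le> card (self_avoiding_paths m) * card (self_avoiding_paths n)"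
proof -
  \<comment> \<open>Both parts keep the vertex \<open>xs ! m\<close>: it ends the first part, and
    reading it off there undoes the translation of the second.\<close>
  define f where "f xs = (take (Suc m) xs, map (\<lambda>x. x - xs ! m) (drop m xs))" for xs :: "(real ^ 3) list"
  have "inj_on f (self_avoiding_paths (m + n))"
  proof (rule inj_onI)
    fix xs ys assume "xs \<in> self_avoiding_paths (m + n)" "ys \<in> self_avoiding_paths (m + n)" "f xs = f ys"
    then have t: "take (Suc m) xs = take (Suc m) ys"
      and d: "map (\<lambda>x. x - xs ! m) (drop m xs) = map (\<lambda>x. x - ys ! m) (drop m ys)"
      by (auto simp: f_def)
    have "xs ! m = ys ! m" using t by (metis lessI nth_take)
    then have "drop m xs = drop m ys" using d by (auto simp: inj_def dest: map_injective)
    moreover have "take m xs = take m ys" using t by (metis le_add2 min.absorb1 plus_1_eq_Suc take_take)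
    ultimately show "xs = ys" by (metis append_take_drop_id)
  qed
  moreover have "f ` self_avoiding_paths (m + n) \<subseteq> self_avoiding_paths m \<times> self_avoiding_paths n"
  proof (rule image_subsetI)
    fix xs assume "xs \<in> self_avoiding_paths (m + n)"
    then have xs: "length xs = Suc (m + n)" "hd xs = 0" "set xs \<subseteq> sites" "distinct xs"
      "\<And>i. i < m + n \<Longrightarrow> l1_norm (xs ! Suc i - xs ! i) = 1"
      by (auto simp: self_avoiding_paths_def)
    have "take (Suc m) xs \<in> self_avoiding_paths m"
      using xs set_take_subset[of "Suc m" xs] by (auto simp: self_avoiding_paths_def)
    moreover have "map (\<lambda>x. x - xs ! m) (drop m xs) \<in> self_avoiding_paths n"
    proof -
      have "xs ! m \<in> sites" using xs by (auto simp: subset_iff)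
      then have "set (map (\<lambda>x. x - xs ! m) (drop m xs)) \<subseteq> sites"
        using xs(3) set_drop_subset[of m xs] by (auto intro: diff_mem_sites)
      moreover have "distinct (map (\<lambda>x. x - xs ! m) (drop m xs))"
        using xs(4) by (simp add: distinct_map inj_on_def)
      moreover have "hd (map (\<lambda>x. x - xs ! m) (drop m xs)) = 0"
        using xs(1) by (simp add: hd_map hd_drop_conv_nth)
      ultimately show ?thesis using xs(1,5) by (simp add: self_avoiding_paths_def)
    qed
    ultimately show "f xs \<in> self_avoiding_paths m \<times> self_avoiding_paths n" by (simp add: f_def)
  qed
  ultimately have "card (self_avoiding_paths (m + n)) \<le> card (self_avoiding_paths m \<times> self_avoiding_paths n)"
    using finite_self_avoiding_paths by (intro card_inj_on_le) auto
  then show ?thesis by (simp add: card_cartesian_product)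
qed

text \<open>The constant is defined by \<open>lim\<close>, which gives a limit only once convergence
  is known; submultiplicativity supplies it.\<close>

lemma connective_constant_LIMSEQ:
  "(\<lambda>k. root k (real (card (self_avoiding_paths k)))) \<longlonglongrightarrow> connective_constant"
proof -
  have "convergent (\<lambda>k. root k (real (card (self_avoiding_paths k))))"
  proof (rule convergent_root_submultiplicative)
    show "1 \<le> real (card (self_avoiding_paths k))" for k using card_self_avoiding_paths_ge_1 by simp
    show "real (card (self_avoiding_paths (m + n)))
      \<le> real (card (self_avoiding_paths m)) * real (card (self_avoiding_paths n))" for m n
      unfolding of_nat_mult[symmetric] of_nat_le_iff by (rule card_self_avoiding_paths_add)
  qed
  then show ?thesis by (simp add: connective_constant_def convergent_LIMSEQ_iff)
qed

lemma connective_constant_ge_1: "connective_constant \<ge> 1"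
proof (rule LIMSEQ_le_const[OF connective_constant_LIMSEQ])
  show "\<exists>N. \<forall>k\<ge>N. 1 \<le> root k (real (card (self_avoiding_paths k)))"
    using card_self_avoiding_paths_ge_1 by (intro exI[of _ 1]) (simp add: Suc_le_eq)
qed

lemma card_self_avoiding_paths_le:
  assumes "\<mu> > connective_constant"
  obtains C where "C > 0" "\<And>k. real (card (self_avoiding_paths k)) \<le> C * \<mu> ^ k"
proof -
  have mu: "\<mu> \<ge> 1" using assms connective_constant_ge_1 by linarith
  have "\<forall>\<^sub>F k in sequentially. root k (real (card (self_avoiding_paths k))) < \<mu>"
    using connective_constant_LIMSEQ assms by (rule order_tendstoD)
  then obtain N where N: "\<And>k. k \<ge> N \<Longrightarrow> root k (real (card (self_avoiding_paths k))) < \<mu>"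
    by (auto simp: eventually_sequentially)
  \<comment> \<open>The sum covers the lengths up to \<open>N\<close>; the extra 1 makes
    \<open>C\<close> at least 1, which serves all longer paths.\<close>
  define C where "C = 1 + (\<Sum>k\<le>N. real (card (self_avoiding_paths k)))"
  have C1: "C \<ge> 1" by (simp add: C_def sum_nonneg)
  have "real (card (self_avoiding_paths k)) \<le> C * \<mu> ^ k" for k
  proof (cases "k \<le> N")
    case True
    then have "real (card (self_avoiding_paths k)) \<le> (\<Sum>k\<le>N. real (card (self_avoiding_paths k)))"
      by (intro member_le_sum) auto
    then have "real (card (self_avoiding_paths k)) \<le> C * 1" by (simp add: C_def)
    also have "\<dots> \<le> C * \<mu> ^ k" using C1 mu by (intro mult_left_mono) auto
    finally show ?thesis .
  next
    case False
    then have "real (card (self_avoiding_paths k)) = root k (real (card (self_avoiding_paths k))) ^ k" by simp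
    also have "\<dots> \<le> \<mu> ^ k" using False N[of k] by (intro power_mono) auto
    also have "\<dots> \<le> C * \<mu> ^ k" using C1 mu mult_right_mono[of 1 C "\<mu> ^ k"] by simp
    finally show ?thesis .
  qed
  then show thesis using that[of C] C1 by simp
qed

section \<open>Sites reachable with outward steps along occupied bonds\<close>

definition oriented_step :: "((real ^ 3) set \<Rightarrow> bool) \<Rightarrow> real ^ 3 \<Rightarrow> real ^ 3 \<Rightarrow> bool"
  where "oriented_step \<omega> x y \<longleftrightarrow>
    adjacent x y \<and> (l1_norm x < l1_norm y \<longrightarrow> closed_segment x y \<in> occupied \<omega>)"

definition reachable :: "((real ^ 3) set \<Rightarrow> bool) \<Rightarrow> (real ^ 3) set"
  where "reachable \<omega> = {x. (oriented_step \<omega>)\<^sup>*\<^sup>* 0 x}"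

lemma zero_mem_reachable: "0 \<in> reachable \<omega>"
  by (simp add: reachable_def)

lemma reachable_step: "x \<in> reachable \<omega> \<Longrightarrow> oriented_step \<omega> x y \<Longrightarrow> y \<in> reachable \<omega>"
  unfolding reachable_def by (simp add: rtranclp.rtrancl_into_rtrancl)

lemma reachable_sites: "reachable \<omega> \<subseteq> sites"
proof
  fix x assume "x \<in> reachable \<omega>"
  then have "(oriented_step \<omega>)\<^sup>*\<^sup>* 0 x" by (simp add: reachable_def)
  then show "x \<in> sites" by (cases rule: rtranclp.cases) (auto simp: oriented_step_def adjacent_def)
qed

text \<open>Induction on the norm of \<open>x\<close>: while \<open>x\<close> differs from
  \<open>y\<close>, some coordinate of \<open>x\<close> can move by 1 towards 0 and still dominate
  that of \<open>y\<close>, and such an inward step is always allowed.\<close>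

lemma reachable_down_closed:
  assumes "x \<in> reachable \<omega>" "y \<in> sites" "\<And>i. \<bar>y $ i\<bar> \<le> \<bar>x $ i\<bar> \<and> 0 \<le> x $ i * y $ i"
  shows "y \<in> reachable \<omega>"
  using assms
proof (induction "nat \<lfloor>l1_norm x\<rfloor>" arbitrary: x rule: less_induct)
  case less
  show ?case
  proof (cases "x = y")
    case False
    then obtain i where i: "x $ i \<noteq> y $ i" by (auto simp: vec_eq_iff)
    have x: "x \<in> sites" using less.prems reachable_sites by blast
    \<comment> \<open>Since \<open>x $ i\<close> and \<open>y $ i\<close> differ without having
      opposite signs, \<open>y $ i\<close> is strictly nearer to 0, and integrality leaves room for
      a full unit step.\<close>
    define x' where "x' = x - axis i (sgn (x $ i))"
    have other: "x' $ j = x $ j" if "j \<noteq> i" for j using that by (simp add: x'_def axis_def)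
    have xi': "x' $ i = x $ i - sgn (x $ i)" by (simp add: x'_def axis_def)
    have xi: "\<bar>y $ i\<bar> \<le> \<bar>x $ i\<bar>" "0 \<le> x $ i * y $ i" using less.prems(3) by auto
    have x0: "x $ i \<noteq> 0" using xi i by auto
    obtain a b where ab: "x $ i = of_int a" "y $ i = of_int b"
      using x less.prems(2) by (auto simp: sites_def) (metis Ints_cases)
    have yi: "\<bar>y $ i\<bar> \<le> \<bar>x' $ i\<bar> \<and> 0 \<le> x' $ i * y $ i \<and> \<bar>x' $ i\<bar> = \<bar>x $ i\<bar> - 1"
    proof (cases "x $ i > 0")
      case True
      then have "y $ i \<ge> 0" using xi by (simp add: zero_le_mult_iff)
      then have "b \<ge> 0" "b < a" using xi i True ab by auto
      then show ?thesis using True ab by (auto simp: xi' simp flip: of_int_diff)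
    next
      case False
      then have neg: "x $ i < 0" using x0 by simp
      then have "y $ i \<le> 0" using xi by (simp add: zero_le_mult_iff)
      then have "b \<le> 0" "a < b" using xi i neg ab by auto
      then show ?thesis using neg ab by (auto simp: xi' mult_nonpos_nonpos)
    qed
    have x': "x' \<in> sites"
      unfolding sites_def
    proof (intro CollectI allI)
      show "x' $ j \<in> \<int>" for j
        using x xi' other by (cases "j = i") (auto simp: sites_def sgn_if)
    qed
    have norm: "l1_norm x' = l1_norm x - 1"
    proof -
      have "(\<Sum>j \<in> UNIV - {i}. \<bar>x' $ j\<bar>) = (\<Sum>j \<in> UNIV - {i}. \<bar>x $ j\<bar>)"
        using other by (intro sum.cong) auto
      then show ?thesis using l1_norm_split[of x i] l1_norm_split[of x' i] yi by linarith
    qed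
    have "l1_norm (x - x') = 1"
      unfolding x'_def using x0 by (subst l1_norm_split[of _ i]) (simp add: axis_def sgn_if)
    then have "oriented_step \<omega> x x'" using x x' norm by (simp add: oriented_step_def adjacent_def)
    then have "x' \<in> reachable \<omega>" using less.prems(1) by (rule reachable_step[rotated])
    moreover have "nat \<lfloor>l1_norm x'\<rfloor> < nat \<lfloor>l1_norm x\<rfloor>"
      using norm l1_norm_nonneg[of x'] by linarith
    moreover have "\<bar>y $ j\<bar> \<le> \<bar>x' $ j\<bar> \<and> 0 \<le> x' $ j * y $ j" for j
      using yi other less.prems(3)[of j] by (cases "j = i") auto
    ultimately show ?thesis using less.hyps less.prems(2) by blast
  qed (use less in simp)
qed

lemma down_closed_sites_reachable: "finite (reachable \<omega>) \<Longrightarrow> down_closed_sites (reachable \<omega>)"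
  by unfold_locales (use reachable_sites zero_mem_reachable reachable_down_closed in blast)+

text \<open>An occupied bond may be crossed both ways, whichever way is outward. This gives the
  hypothesis \<open>same\<close> of \<open>one_entangled_subset_body\<close>.\<close>

lemma reachable_occupied_bond:
  assumes "adjacent x y" "closed_segment x y \<in> occupied \<omega>"
  shows "x \<in> reachable \<omega> \<longleftrightarrow> y \<in> reachable \<omega>"
proof -
  have "oriented_step \<omega> x y" "oriented_step \<omega> y x"
    using assms adjacent_sym by (auto simp: oriented_step_def closed_segment_commute)
  then show ?thesis using reachable_step by blast
qed

section \<open>Large entangled sets force far reachable sites\<close>

lemma infinite_sites_far:
  assumes "infinite R" "R \<subseteq> sites"
  shows "\<exists>x\<in>R. l1_norm x \<ge> r"
proof (rule ccontr)
  assume "\<not> (\<exists>x\<in>R. l1_norm x \<ge> r)"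
  then have "R \<subseteq> {x \<in> sites. \<forall>i. \<bar>x $ i\<bar> \<le> r}"
    using assms(2) abs_nth_le_l1_norm by (fastforce intro: order_trans)
  then show False using assms(1) finite_sites_bounded finite_subset by blast
qed

text \<open>If only finitely many sites were reachable, \<open>K\<close> would stay in the body over
  them and hence be finite.\<close>

lemma reachable_far_if_infinite_entangled:
  assumes "K \<subseteq> occupied \<omega>" "infinite K" "one_entangled K" "0 \<in> \<Union> K"
  shows "\<exists>x\<in>reachable \<omega>. l1_norm x \<ge> r"
proof (cases "finite (reachable \<omega>)")
  case True
  then interpret down_closed_sites "reachable \<omega>" by (rule down_closed_sites_reachable)
  have "\<Union> K \<subseteq> body"
    using assms reachable_occupied_bond by (intro one_entangled_subset_body) blast+
  then show ?thesis using one_entangled_finite assms by blast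
qed (intro infinite_sites_far reachable_sites)

lemma reachable_far_if_rad_ge:
  assumes "rad (\<Union> (entanglement_cluster \<omega> 0)) \<ge> ennreal r" "r > 0"
  shows "\<exists>x\<in>reachable \<omega>. l1_norm x \<ge> r"
proof (cases "finite (reachable \<omega>)")
  case True
  then interpret down_closed_sites "reachable \<omega>" by (rule down_closed_sites_reachable)
  let ?K = "entanglement_cluster \<omega> 0"
  \<comment> \<open>As \<open>r > 0\<close>, the cluster is not the empty default, whose radius is
    0.\<close>
  have "\<exists>e\<in>occupied \<omega>. 0 \<in> e"
  proof (rule ccontr)
    assume "\<not> ?thesis"
    then have "?K = {}" by (simp add: entanglement_cluster_def)
    then have "rad (\<Union> ?K) = 0" by (simp add: rad_def bot_ennreal)
    then show False using assms by (simp add: ennreal_eq_0_iff)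
  qed
  then obtain e where "e \<in> occupied \<omega>" "0 \<in> e" by blast
  note K = entanglement_cluster_greatest(1-3)[OF this]
  have "\<Union> ?K \<subseteq> body"
    using K reachable_occupied_bond by (intro one_entangled_subset_body) blast+
  then have "rad (\<Union> ?K) \<le> ennreal (Max (l1_norm ` reachable \<omega>))"
    using K by (intro rad_le_Max)
  \<comment> \<open>The maximum is attained, so the bound on the radius is the norm of a reachable
    site.\<close>
  moreover have "Max (l1_norm ` reachable \<omega>) \<in> l1_norm ` reachable \<omega>"
    using True zero_mem_reachable by (intro Max_in) auto
  then obtain x where x: "x \<in> reachable \<omega>" "Max (l1_norm ` reachable \<omega>) = l1_norm x" by auto
  ultimately have "ennreal r \<le> ennreal (l1_norm x)" using assms(1) by (metis order_trans)
  then have "r \<le> l1_norm x" using l1_norm_nonneg by (simp add: ennreal_le_iff)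
  then show ?thesis using x by blast
qed (intro infinite_sites_far reachable_sites)

section \<open>Path counting\<close>

definition outward_bonds :: "(real ^ 3) list \<Rightarrow> (real ^ 3) set set"
  where "outward_bonds xs = {closed_segment (xs ! i) (xs ! Suc i) | i.
    Suc i < length xs \<and> l1_norm (xs ! i) < l1_norm (xs ! Suc i)}"

lemma self_avoiding_paths_adjacent:
  assumes "xs \<in> self_avoiding_paths k" "i < k"
  shows "adjacent (xs ! i) (xs ! Suc i)"
proof -
  have "xs ! i \<in> set xs" "xs ! Suc i \<in> set xs" "l1_norm (xs ! Suc i - xs ! i) = 1" "set xs \<subseteq> sites"
    using assms by (auto simp: self_avoiding_paths_def)
  then show ?thesis by (auto simp: adjacent_def l1_norm_minus_commute)
qed

lemma outward_bonds_subset_bonds: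
  assumes "xs \<in> self_avoiding_paths k"
  shows "outward_bonds xs \<subseteq> bonds"
proof
  fix e assume "e \<in> outward_bonds xs"
  then obtain i where i: "e = closed_segment (xs ! i) (xs ! Suc i)" "Suc i < length xs"
    by (auto simp: outward_bonds_def)
  have "i < k" using i(2) assms by (simp add: self_avoiding_paths_def)
  then show "e \<in> bonds" using self_avoiding_paths_adjacent[OF assms] i(1) unfolding bonds_eq by blast
qed

lemma outward_bonds_take_subset: "outward_bonds (take n xs) \<subseteq> outward_bonds xs"
  by (auto simp: outward_bonds_def)

lemma outward_bonds_snoc_subset:
  assumes "xs \<noteq> []"
  shows "outward_bonds (xs @ [z]) \<subseteq> outward_bonds xs \<union>
    (if l1_norm (last xs) < l1_norm z then {closed_segment (last xs) z} else {})"
proof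
  fix e assume "e \<in> outward_bonds (xs @ [z])"
  then obtain i where i: "e = closed_segment ((xs @ [z]) ! i) ((xs @ [z]) ! Suc i)" "i < length xs"
    "l1_norm ((xs @ [z]) ! i) < l1_norm ((xs @ [z]) ! Suc i)"
    unfolding outward_bonds_def by auto
  show "e \<in> outward_bonds xs \<union>
    (if l1_norm (last xs) < l1_norm z then {closed_segment (last xs) z} else {})"
  proof (cases "Suc i < length xs")
    case True
    then have "e \<in> outward_bonds xs"
      unfolding outward_bonds_def using i by (auto simp: nth_append)
    then show ?thesis by blast
  next
    case False
    then have "Suc i = length xs" using i by simp
    then have "xs ! i = last xs" using assms by (metis last_conv_nth diff_Suc_1)
    then show ?thesis using i \<open>Suc i = length xs\<close> by (simp add: nth_append)
  qed
qed

text \<open>Loop erasure: if the next site was visited before, the path is cut back to that visit,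
  which adds no outward bond; otherwise the path is extended.\<close>

lemma reachable_self_avoiding_path:
  assumes "x \<in> reachable \<omega>"
  shows "\<exists>k. \<exists>xs \<in> self_avoiding_paths k. last xs = x \<and> outward_bonds xs \<subseteq> occupied \<omega>"
proof -
  have "(oriented_step \<omega>)\<^sup>*\<^sup>* 0 x" using assms by (simp add: reachable_def)
  then show ?thesis
  proof (induction rule: rtranclp_induct)
    case base
    have "[0] \<in> self_avoiding_paths 0" by (simp add: self_avoiding_paths_def)
    then show ?case by (intro exI bexI[of _ "[0]"]) (auto simp: outward_bonds_def)
  next
    case (step y z)
    then obtain k xs where k: "xs \<in> self_avoiding_paths k" "last xs = y" "outward_bonds xs \<subseteq> occupied \<omega>"
      by blast
    then have xs: "length xs = Suc k" "hd xs = 0" "set xs \<subseteq> sites" "distinct xs"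
      "\<And>i. i < k \<Longrightarrow> l1_norm (xs ! Suc i - xs ! i) = 1" by (auto simp: self_avoiding_paths_def)
    then have ne: "xs \<noteq> []" by auto
    show ?case
    proof (cases "z \<in> set xs")
      case True
      then obtain j where j: "j \<le> k" "xs ! j = z" using xs(1) by (metis in_set_conv_nth less_Suc_eq_le)
      have "take (Suc j) xs \<in> self_avoiding_paths j"
        using xs j ne set_take_subset[of "Suc j" xs] by (auto simp: self_avoiding_paths_def)
      moreover have "last (take (Suc j) xs) = z"
        using j xs(1) by (simp add: take_Suc_conv_app_nth)
      moreover have "outward_bonds (take (Suc j) xs) \<subseteq> occupied \<omega>"
        using k(3) outward_bonds_take_subset by blast
      ultimately show ?thesis by blast
    next
      case False
      have yz: "adjacent y z" "l1_norm y < l1_norm z \<Longrightarrow> closed_segment y z \<in> occupied \<omega>"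
        using step.hyps by (auto simp: oriented_step_def)
      have "xs @ [z] \<in> self_avoiding_paths (Suc k)"
      proof -
        have "l1_norm ((xs @ [z]) ! Suc i - (xs @ [z]) ! i) = 1" if "i < Suc k" for i
        proof (cases "i < k")
          case True
          then show ?thesis using xs by (simp add: nth_append)
        next
          case False
          then have "i = k" using that by simp
          moreover have "xs ! k = y" using k(2) xs(1) ne by (simp add: last_conv_nth)
          ultimately show ?thesis
            using yz(1) xs(1) by (simp add: nth_append adjacent_def l1_norm_minus_commute)
        qed
        then show ?thesis
          using xs False ne yz(1) by (simp add: self_avoiding_paths_def adjacent_def)
      qed
      moreover have "outward_bonds (xs @ [z]) \<subseteq> occupied \<omega>"
        using outward_bonds_snoc_subset[OF ne, of z] k yz(2) by (auto split: if_splits)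
      ultimately show ?thesis by (intro exI bexI[of _ "xs @ [z]"]) auto
    qed
  qed
qed

lemma finite_outward_bonds: "finite (outward_bonds xs)"
  unfolding outward_bonds_def
  by (rule finite_subset[of _ "(\<lambda>i. closed_segment (xs ! i) (xs ! Suc i)) ` {..<length xs}"]) auto

text \<open>The norm starts at 0 and changes by 1 in each of the \<open>k\<close> steps, so outward
  minus inward steps is the final norm. Self-avoidance makes the bonds of different steps distinct,
  so counting bonds counts steps.\<close>

lemma card_outward_bonds:
  assumes xs: "xs \<in> self_avoiding_paths k"
  shows "2 * real (card (outward_bonds xs)) = real k + l1_norm (last xs)"
proof -
  define U where "U j = {i. i < j \<and> l1_norm (xs ! i) < l1_norm (xs ! Suc i)}" for j
  have len: "length xs = Suc k" and dist: "distinct xs" and hd: "hd xs = 0"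
    using xs by (auto simp: self_avoiding_paths_def)
  have ne: "xs \<noteq> []" using len by auto
  have "2 * real (card (U j)) = real j + l1_norm (xs ! j)" if "j \<le> k" for j
    using that
  proof (induction j)
    case 0
    then show ?case using hd ne by (simp add: U_def hd_conv_nth)
  next
    case (Suc j)
    have fin: "finite (U j)" by (simp add: U_def)
    have U: "U (Suc j) = (if l1_norm (xs ! j) < l1_norm (xs ! Suc j) then insert j (U j) else U j)"
      by (auto simp: U_def less_Suc_eq)
    have "l1_norm (xs ! Suc j) = l1_norm (xs ! j) + 1 \<or> l1_norm (xs ! Suc j) = l1_norm (xs ! j) - 1"
      using adjacent_l1_norm self_avoiding_paths_adjacent[OF xs] Suc.prems by simp
    moreover have "j \<notin> U j" by (simp add: U_def)
    ultimately show ?case using Suc fin by (auto simp: U)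
  qed
  then have "2 * real (card (U k)) = real k + l1_norm (last xs)" using len ne by (simp add: last_conv_nth)
  moreover have "outward_bonds xs = (\<lambda>i. closed_segment (xs ! i) (xs ! Suc i)) ` U k"
    using len by (auto simp: outward_bonds_def U_def)
  moreover have "inj_on (\<lambda>i. closed_segment (xs ! i) (xs ! Suc i)) (U k)"
  proof (rule inj_onI)
    fix i j assume ij: "i \<in> U k" "j \<in> U k" "closed_segment (xs ! i) (xs ! Suc i) = closed_segment (xs ! j) (xs ! Suc j)"
    then have lt: "i < k" "j < k" by (auto simp: U_def)
    \<comment> \<open>Equal segments have the same ends, possibly swapped; a swap would mean
      \<open>i = Suc j\<close> and \<open>Suc i = j\<close>.\<close>
    have "xs ! i = xs ! j \<or> xs ! i = xs ! Suc j \<and> xs ! Suc i = xs ! j"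
      using ij(3) by (simp add: doubleton_eq_iff) blast
    then show "i = j" using lt len dist by (auto simp: nth_eq_iff_index_eq)
  qed
  ultimately show ?thesis by (simp add: card_image)
qed

section \<open>Probability of reaching far sites\<close>

lemma prob_space_percolation: "prob_space (percolation p)"
  unfolding percolation_def by (intro prob_space_PiM) (rule measure_pmf.prob_space_axioms)

lemma cylinder_percolation:
  assumes J: "J \<subseteq> bonds" "finite J" and p: "0 \<le> p" "p \<le> 1"
  shows "{\<omega> \<in> space (percolation p). \<forall>e\<in>J. \<omega> e} \<in> sets (percolation p)"
    and "measure (percolation p) {\<omega> \<in> space (percolation p). \<forall>e\<in>J. \<omega> e} = p ^ card J"
proof -
  let ?M = "\<lambda>_ :: (real ^ 3) set. measure_pmf (bernoulli_pmf p)"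
  have eq: "{\<omega> \<in> space (percolation p). \<forall>e\<in>J. \<omega> e} = prod_emb bonds ?M J (Pi\<^sub>E J (\<lambda>_. {True}))"
  proof -
    have "restrict \<omega> J \<in> Pi\<^sub>E J (\<lambda>_. {True}) \<longleftrightarrow> (\<forall>e\<in>J. \<omega> e)" for \<omega> :: "(real ^ 3) set \<Rightarrow> bool"
      unfolding PiE_iff by simp
    then have "\<omega> \<in> prod_emb bonds ?M J (Pi\<^sub>E J (\<lambda>_. {True}))
        \<longleftrightarrow> \<omega> \<in> space (percolation p) \<and> (\<forall>e\<in>J. \<omega> e)" for \<omega>
      unfolding prod_emb_def percolation_def space_PiM Int_iff vimage_eq by blast
    then show ?thesis by blast
  qed
  show "{\<omega> \<in> space (percolation p). \<forall>e\<in>J. \<omega> e} \<in> sets (percolation p)"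
    unfolding eq unfolding percolation_def using J by (intro sets_PiM_I) auto
  have "emeasure (percolation p) {\<omega> \<in> space (percolation p). \<forall>e\<in>J. \<omega> e}
      = (\<Prod>e\<in>J. emeasure (measure_pmf (bernoulli_pmf p)) {True})"
    unfolding eq unfolding percolation_def using J
    by (intro emeasure_PiM_emb) (auto intro: measure_pmf.prob_space_axioms)
  also have "\<dots> = ennreal (p ^ card J)"
    using p by (simp add: emeasure_pmf_single ennreal_power)
  finally show "measure (percolation p) {\<omega> \<in> space (percolation p). \<forall>e\<in>J. \<omega> e} = p ^ card J"
    using p by (simp add: measure_def)
qed

text \<open>
  The bound is for subsets \<open>A\<close> of the event, because the events it is applied to are not shown to be
  measurable.
\<close>

lemma measure_reachable_far_le_growth:
  assumes p: "0 \<le> p" "p \<le> 1" and mu: "\<mu> > connective_constant" "\<mu> * sqrt p < 1"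
  obtains C where "C > 0"
    "\<And>A n. A \<subseteq> {\<omega> \<in> space (percolation p). \<exists>x\<in>reachable \<omega>. l1_norm x \<ge> real n}
      \<Longrightarrow> measure (percolation p) A \<le> C * (\<mu> * p) ^ n"
proof -
  interpret P: prob_space "percolation p" by (rule prob_space_percolation)
  obtain C where C: "C > 0" "\<And>k. real (card (self_avoiding_paths k)) \<le> C * \<mu> ^ k"
    using card_self_avoiding_paths_le[OF mu(1)] by blast
  have mu0: "\<mu> > 0" using mu(1) connective_constant_ge_1 by linarith
  \<comment> \<open>Half-integral powers of \<open>p\<close> become natural powers of
    \<open>s\<close>.\<close>
  define s where "s = sqrt p"
  have s: "0 \<le> s" "s \<le> 1" "s ^ 2 = p" using p by (auto simp: s_def)
  have ms: "0 \<le> \<mu> * s" "\<mu> * s < 1" using mu0 s mu(2) by (auto simp: s_def)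
  define G where "G xs = {\<omega> \<in> space (percolation p). \<forall>e\<in>outward_bonds xs. \<omega> e}" for xs
  have "P.prob A \<le> C / (1 - \<mu> * s) * (\<mu> * p) ^ n"
    if A: "A \<subseteq> {\<omega> \<in> space (percolation p). \<exists>x\<in>reachable \<omega>. l1_norm x \<ge> real n}" for A n
  proof -
    \<comment> \<open>\<open>j\<close> counts the steps beyond the \<open>n\<close> that any path to
      norm \<open>n\<close> must have.\<close>
    define S where "S j = {xs \<in> self_avoiding_paths (j + n). l1_norm (last xs) \<ge> real n}" for j
    define B where "B j = (\<Union>xs\<in>S j. G xs)" for j
    have finS: "finite (S j)" for j unfolding S_def using finite_self_avoiding_paths by simp
    have G: "G xs \<in> P.events" "P.prob (G xs) \<le> s ^ (j + 2 * n)" if "xs \<in> S j" for xs j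
    proof -
      have xs: "xs \<in> self_avoiding_paths (j + n)" "l1_norm (last xs) \<ge> real n" using that by (auto simp: S_def)
      note cyl = cylinder_percolation[OF outward_bonds_subset_bonds[OF xs(1)] finite_outward_bonds p]
      show "G xs \<in> P.events" unfolding G_def by (rule cyl)
      have "j + 2 * n \<le> 2 * card (outward_bonds xs)" using card_outward_bonds[OF xs(1)] xs(2) by linarith
      then have "s ^ (2 * card (outward_bonds xs)) \<le> s ^ (j + 2 * n)" using s by (intro power_decreasing)
      then show "P.prob (G xs) \<le> s ^ (j + 2 * n)"
        unfolding G_def cyl(2) by (simp add: power_mult s(3))
    qed
    have B: "B j \<in> P.events" for j unfolding B_def using finS G by (intro sets.finite_UN) auto
    have prob_B: "P.prob (B j) \<le> C * (\<mu> * p) ^ n * (\<mu> * s) ^ j" for j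
    proof -
      have "P.prob (B j) \<le> (\<Sum>xs\<in>S j. P.prob (G xs))"
        unfolding B_def using finS G by (intro P.finite_measure_subadditive_finite) auto
      also have "\<dots> \<le> (\<Sum>xs\<in>S j. s ^ (j + 2 * n))" using G by (intro sum_mono)
      also have "\<dots> = real (card (S j)) * s ^ (j + 2 * n)" by simp
      also have "\<dots> \<le> (C * \<mu> ^ (j + n)) * s ^ (j + 2 * n)"
      proof (intro mult_right_mono)
        have "card (S j) \<le> card (self_avoiding_paths (j + n))"
          unfolding S_def using finite_self_avoiding_paths by (intro card_mono) auto
        then show "real (card (S j)) \<le> C * \<mu> ^ (j + n)" using C(2)[of "j + n"] by linarith
      qed (use s in simp)
      \<comment> \<open>The powers are regrouped into the wanted rate in \<open>n\<close> and a
        geometric term in \<open>j\<close> of ratio \<open>\<mu> * s < 1\<close>.\<close>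
      also have "\<dots> = C * (\<mu> * s ^ 2) ^ n * (\<mu> * s) ^ j"
        by (simp add: power_add power_mult_distrib mult_ac flip: power_mult)
      finally show ?thesis by (simp add: s(3))
    qed
    have geom: "(\<lambda>j. C * (\<mu> * p) ^ n * (\<mu> * s) ^ j) sums (C * (\<mu> * p) ^ n * (1 / (1 - \<mu> * s)))"
      using ms by (intro sums_mult geometric_sums) simp
    have summ: "summable (\<lambda>j. P.prob (B j))"
      using sums_summable[OF geom] by (rule summable_comparison_test'[where N = 0]) (use prob_B in simp)
    have sub: "A \<subseteq> (\<Union>j. B j)"
    proof
      fix \<omega> assume "\<omega> \<in> A"
      then obtain x where x: "\<omega> \<in> space (percolation p)" "x \<in> reachable \<omega>" "l1_norm x \<ge> real n"
        using A by blast
      obtain k xs where xs: "xs \<in> self_avoiding_paths k" "last xs = x" "outward_bonds xs \<subseteq> occupied \<omega>"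
        using reachable_self_avoiding_path[OF x(2)] by blast
      have "length xs = Suc k" using xs(1) by (simp add: self_avoiding_paths_def)
      then have "xs ! k = x" using xs(2) last_conv_nth[of xs] by (metis diff_Suc_1 list.size(3) nat.distinct(1))
      then have "n \<le> k" using self_avoiding_paths_l1_norm_le[OF xs(1), of k] x(3) by simp
      then have "xs \<in> S (k - n)" using xs x(3) by (simp add: S_def)
      moreover have "\<omega> \<in> G xs" using xs(3) x(1) by (auto simp: G_def occupied_def)
      ultimately show "\<omega> \<in> (\<Union>j. B j)" by (auto simp: B_def)
    qed
    have "P.prob A \<le> P.prob (\<Union>j. B j)"
      using sub B by (intro P.finite_measure_mono) auto
    also have "\<dots> \<le> (\<Sum>j. P.prob (B j))"
      using B summ by (intro P.finite_measure_subadditive_countably) auto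
    also have "\<dots> \<le> (\<Sum>j. C * (\<mu> * p) ^ n * (\<mu> * s) ^ j)"
      using prob_B summ sums_summable[OF geom] by (intro suminf_le)
    also have "\<dots> = C / (1 - \<mu> * s) * (\<mu> * p) ^ n" using sums_unique[OF geom] by simp
    finally show ?thesis .
  qed
  moreover have "C / (1 - \<mu> * s) > 0" using C ms by simp
  ultimately show thesis using that by blast
qed

text \<open>There is room for a \<open>\<mu>\<close> slightly above the connective constant that
  keeps \<open>\<mu> * p < \<alpha>\<close> and \<open>\<mu> * sqrt p < 1\<close>; the latter is
  where the bound on \<open>p\<close> enters.\<close>

lemma measure_reachable_far_le:
  assumes p: "0 \<le> p" "p < 1 / connective_constant ^ 2" and \<alpha>: "connective_constant * p < \<alpha>" "\<alpha> < 1"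
  obtains C where "C > 0"
    "\<And>A n. A \<subseteq> {\<omega> \<in> space (percolation p). \<exists>x\<in>reachable \<omega>. l1_norm x \<ge> real n}
      \<Longrightarrow> measure (percolation p) A \<le> C * \<alpha> ^ n"
proof -
  let ?\<mu> = connective_constant
  have mu1: "?\<mu> \<ge> 1" by (rule connective_constant_ge_1)
  have "1 / ?\<mu> ^ 2 \<le> 1" using mu1 by simp
  then have p1: "p \<le> 1" using p by linarith
  have "\<exists>\<mu> > ?\<mu>. \<mu> * p < \<alpha> \<and> \<mu> * sqrt p < 1"
  proof (cases "p = 0")
    \<comment> \<open>The upper limits on \<mu> used otherwise divide by \<open>p\<close> and
      \<open>sqrt p\<close>, so \<open>p = 0\<close> is treated apart; any larger \<mu> works
      here.\<close>
    case True
    then show ?thesis using \<alpha> by (intro exI[of _ "?\<mu> + 1"]) auto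
  next
    case False
    then have p0: "p > 0" using p by simp
    have "sqrt p < sqrt (1 / ?\<mu> ^ 2)" using p by simp
    also have "\<dots> = 1 / ?\<mu>" using mu1 by (simp add: real_sqrt_divide)
    finally have "?\<mu> < 1 / sqrt p" using mu1 p0 by (simp add: field_simps)
    moreover have "?\<mu> < \<alpha> / p" using \<alpha> p0 by (simp add: field_simps)
    ultimately obtain \<mu> where "?\<mu> < \<mu>" "\<mu> < min (1 / sqrt p) (\<alpha> / p)"
      using dense[of ?\<mu> "min (1 / sqrt p) (\<alpha> / p)"] by auto
    then show ?thesis using p0 by (intro exI[of _ \<mu>]) (auto simp: field_simps)
  qed
  then obtain \<mu> where mu: "\<mu> > ?\<mu>" "\<mu> * p < \<alpha>" "\<mu> * sqrt p < 1" by blast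
  obtain C where C: "C > 0" "\<And>A n. A \<subseteq> {\<omega> \<in> space (percolation p). \<exists>x\<in>reachable \<omega>. l1_norm x \<ge> real n}
      \<Longrightarrow> measure (percolation p) A \<le> C * (\<mu> * p) ^ n"
    using measure_reachable_far_le_growth[OF p(1) p1 mu(1,3)] by blast
  have "C * (\<mu> * p) ^ n \<le> C * \<alpha> ^ n" for n
    using C(1) mu mu1 p by (intro mult_left_mono power_mono) auto
  then show thesis using that C by (meson order_trans)
qed

section \<open>Vanishing of \<open>eta1\<close>, decay of the radius, and the critical
  probability\<close>

lemma eta1_eq_0:
  assumes p: "0 \<le> p" "p < 1 / connective_constant ^ 2"
  shows "eta1 p = 0"
proof -
  interpret P: prob_space "percolation p" by (rule prob_space_percolation)
  have mu1: "connective_constant \<ge> 1" by (rule connective_constant_ge_1)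
  \<comment> \<open>The product lies below the reciprocal of the constant, hence below 1, which
    leaves room for a rate \<alpha>.\<close>
  have "connective_constant * p < connective_constant * (1 / connective_constant ^ 2)"
    using p mu1 by (intro mult_strict_left_mono) auto
  also have "\<dots> = 1 / connective_constant" using mu1 by (simp add: power2_eq_square)
  also have "\<dots> \<le> 1" using mu1 by simp
  finally obtain \<alpha> where \<alpha>: "connective_constant * p < \<alpha>" "\<alpha> < 1" using dense by blast
  have \<alpha>0: "\<alpha> > 0" using \<alpha>(1) p mu1 mult_nonneg_nonneg[of connective_constant p] by linarith
  obtain C where C: "C > 0" "\<And>A n. A \<subseteq> {\<omega> \<in> space (percolation p). \<exists>x\<in>reachable \<omega>. l1_norm x \<ge> real n}
      \<Longrightarrow> measure (percolation p) A \<le> C * \<alpha> ^ n"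
    using measure_reachable_far_le[OF p \<alpha>] by blast
  \<comment> \<open>An infinite entangled set at 0 forces reachable sites at every distance, so the
    bound holds for every \<open>n\<close>.\<close>
  have "eta1 p \<le> C * \<alpha> ^ n" for n
    unfolding eta1_def using reachable_far_if_infinite_entangled by (intro C(2)) blast
  moreover have "(\<lambda>n. C * \<alpha> ^ n) \<longlonglongrightarrow> C * 0"
    using \<alpha>(2) \<alpha>0 by (intro tendsto_intros LIMSEQ_power_zero) auto
  ultimately have "eta1 p \<le> C * 0" by (intro LIMSEQ_le_const) auto
  then show ?thesis by (simp add: eta1_def measure_le_0_iff)
qed

lemma measure_rad_ge_le:
  assumes p: "0 \<le> p" "p < 1 / connective_constant ^ 2" and \<alpha>: "connective_constant * p < \<alpha>" "\<alpha> < 1"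
  obtains C where "\<And>r. r > 0 \<Longrightarrow> measure (percolation p)
    {\<omega> \<in> space (percolation p). rad (\<Union> (entanglement_cluster \<omega> 0)) \<ge> ennreal r} \<le> C * \<alpha> powr r"
proof -
  have \<alpha>0: "\<alpha> > 0"
    using \<alpha>(1) p connective_constant_ge_1 mult_nonneg_nonneg[of connective_constant p] by linarith
  obtain C where C: "C > 0" "\<And>A n. A \<subseteq> {\<omega> \<in> space (percolation p). \<exists>x\<in>reachable \<omega>. l1_norm x \<ge> real n}
      \<Longrightarrow> measure (percolation p) A \<le> C * \<alpha> ^ n"
    using measure_reachable_far_le[OF p \<alpha>] by blast
  have "measure (percolation p)
      {\<omega> \<in> space (percolation p). rad (\<Union> (entanglement_cluster \<omega> 0)) \<ge> ennreal r} \<le> C * \<alpha> powr r"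
    if r: "r > 0" for r
  proof -
    \<comment> \<open>Norms of sites are integers, so a norm of at least \<open>r\<close> is at
      least \<open>n\<close>; rounding up is harmless because \<alpha> is below 1.\<close>
    define n where "n = nat \<lceil>r\<rceil>"
    have "\<exists>x\<in>reachable \<omega>. l1_norm x \<ge> real n"
      if rad: "rad (\<Union> (entanglement_cluster \<omega> 0)) \<ge> ennreal r" for \<omega>
    proof -
      obtain x where x: "x \<in> reachable \<omega>" "l1_norm x \<ge> r" using reachable_far_if_rad_ge[OF rad r] by blast
      obtain m where "l1_norm x = of_int m"
        using l1_norm_Ints reachable_sites x(1) by (meson Ints_cases subsetD)
      then have "l1_norm x \<ge> real n" using x(2) r by (simp add: n_def ceiling_le_iff)
      then show ?thesis using x(1) by blast
    qed
    then have "measure (percolation p)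
        {\<omega> \<in> space (percolation p). rad (\<Union> (entanglement_cluster \<omega> 0)) \<ge> ennreal r} \<le> C * \<alpha> ^ n"
      by (intro C(2)) blast
    also have "\<dots> = C * \<alpha> powr real n" using \<alpha>0 by (simp add: powr_realpow)
    also have "\<dots> \<le> C * \<alpha> powr r"
      using C(1) \<alpha> \<alpha>0 r by (intro mult_left_mono powr_mono') (auto simp: n_def)
    finally show ?thesis .
  qed
  then show thesis using that by blast
qed

text \<open>Every positive \<open>p\<close> below the bound belongs to the set whose supremum is
  taken, and by density the supremum reaches the bound.\<close>

lemma entanglement_critical_prob_ge: "entanglement_critical_prob \<ge> 1 / connective_constant ^ 2"
proof (rule dense_le_bounded)
  show "0 < 1 / connective_constant ^ 2" using connective_constant_ge_1 by simp
  fix p assume p: "0 < p" "p < 1 / connective_constant ^ 2"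
  have "1 / connective_constant ^ 2 \<le> 1" using connective_constant_ge_1 by simp
  then have "p \<in> {p \<in> {0..1}. eta1 p = 0}" using p eta1_eq_0[of p] by auto
  moreover have "bdd_above {p \<in> {0..1}. eta1 p = 0}" by (intro bdd_aboveI[of _ 1]) auto
  ultimately show "p \<le> entanglement_critical_prob"
    unfolding entanglement_critical_prob_def by (rule cSup_upper)
qed

theorem corollary2:
  shows "entanglement_critical_prob \<ge> 1 / connective_constant ^ 2 \<and>
    (\<forall>p \<in> {0..1}. p < 1 / connective_constant ^ 2 \<longrightarrow>
      (\<forall>\<alpha> :: real. connective_constant * p < \<alpha> \<and> \<alpha> < 1 \<longrightarrow>
        (\<exists>C :: real. \<forall>r :: real. r > 0 \<longrightarrow>
          measure (percolation p)
            {\<omega> \<in> space (percolation p). rad (\<Union> (entanglement_cluster \<omega> 0)) \<ge> ennreal r}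
          \<le> C * \<alpha> powr r)))"
proof (intro conjI ballI allI impI entanglement_critical_prob_ge)
  fix p \<alpha> :: real
  assume "p \<in> {0..1}" "p < 1 / connective_constant ^ 2" "connective_constant * p < \<alpha> \<and> \<alpha> < 1"
  then have p: "0 \<le> p" "p < 1 / connective_constant ^ 2" and \<alpha>: "connective_constant * p < \<alpha>" "\<alpha> < 1"
    by simp_all
  obtain C where "\<And>r. r > 0 \<Longrightarrow> measure (percolation p)
      {\<omega> \<in> space (percolation p). rad (\<Union> (entanglement_cluster \<omega> 0)) \<ge> ennreal r} \<le> C * \<alpha> powr r"
    using measure_rad_ge_le[OF p \<alpha>] by blast
  then show "\<exists>C :: real. \<forall>r :: real. r > 0 \<longrightarrow> measure (percolation p)
      {\<omega> \<in> space (percolation p). rad (\<Union> (entanglement_cluster \<omega> 0)) \<ge> ennreal r} \<le> C * \<alpha> powr r"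
    by blast
qed

end
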